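(* Let $p$ be a prime and let $X_{p,i}$, $i \in \mathbb{Z}_{>0}$, be independent commuting indeterminates over $\mathbb{F}_p$. Define $$f_{p,1} := X_{p,1}^p - X_{p,1} - 1,$$ $$f_{p,i} := X_{p,i}^p - X_{p,i} - \Big(\prod_{j=1}^{i-1} X_{p,j}\Big)^{p-1} \quad \text{for } i \geq 2.$$ Then for each $l \in \mathbb{Z}_{>0}$ the sequence $((X_{p,i}, f_{p,i}),\ 1 \leq i \leq l)$ defines a tower of field extensions over $\mathbb{F}_p$ in which each step has degree $p$.
   Context: $\mathbb{F}_p$ denotes the field with $p$ elements. Tower of field extensions: let $F$ be a field and $X_1,\ldots,X_l$ independent commuting indeterminates over $F$. For $i=1,\ldots,l$ let $f_i \in F[X_1,\ldots,X_{i-1}][X_i]$ be monic in the variable $X_i$. The sequence $((X_i,f_i),\ i=1,\ldots,l)$ defines a tower of (algebraic) field extensions over $F$ if for each $i=1,\ldots,l$ the residue class of $f_i$ in $F[X_1,\ldots,X_{i-1}][X_i]/(f_1,\ldots,f_{i-1}) = (F[X_1,\ldots,X_{i-1}]/(f_1,\ldots,f_{i-1}))[X_i]$ is irreducible. In that case one has a chain of fields $F = F_0 \leq F_1 \leq \cdots \leq F_l$ with $F_i = F[X_1,\ldots,X_i]/(f_1,\ldots,f_i)$, and the degree $[F_i:F_{i-1}]$ is the degree of $f_i$ in $X_i$. *)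

theory Defs
  imports "HOL-Algebra.Algebra" "HOL-Library.Poly_Mapping"
begin

(* Polynomials over 'a in the commuting indeterminates X_0, X_1, X_2, ...:
   a monomial is the finitely supported map from indices to exponents. *)

type_synonym 'a mpoly = "(nat \<Rightarrow>\<^sub>0 nat) \<Rightarrow>\<^sub>0 'a"

definition indet :: "nat \<Rightarrow> 'a::comm_ring_1 mpoly" where
  "indet i = Poly_Mapping.single (Poly_Mapping.single i 1) 1"

(* F[X_1, ..., X_i], where F is the field given by the type 'a; X_0 is never used *)

definition mpoly_ring :: "nat \<Rightarrow> 'a::field mpoly ring" where
  "mpoly_ring i =
     \<lparr>carrier = {g. \<forall>m \<in> Poly_Mapping.keys g. Poly_Mapping.keys m \<subseteq> {1..i}},
      monoid.mult = (*), one = 1, ring.zero = 0, add = (+)\<rparr>"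

(* Degree and coefficients of g viewed as a polynomial in X_i; the coefficients are
   polynomials in the other indeterminates. *)

definition deg_in :: "nat \<Rightarrow> 'a::zero mpoly \<Rightarrow> nat" where
  "deg_in i g = Max (insert 0 ((\<lambda>m. Poly_Mapping.lookup m i) ` Poly_Mapping.keys g))"

definition coeff_in :: "nat \<Rightarrow> 'a::comm_ring_1 mpoly \<Rightarrow> nat \<Rightarrow> 'a mpoly" where
  "coeff_in i g n =
     (\<Sum>m \<in> {m \<in> Poly_Mapping.keys g. Poly_Mapping.lookup m i = n}.
        Poly_Mapping.single (m - Poly_Mapping.single i n) (Poly_Mapping.lookup g m))"

definition monic_in :: "nat \<Rightarrow> 'a::comm_ring_1 mpoly \<Rightarrow> bool" where
  "monic_in i g \<longleftrightarrow> coeff_in i g (deg_in i g) = 1"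

(* tower_ideal f i j is the ideal (f_1, ..., f_j) of F[X_1, ..., X_i]. *)

definition tower_ideal :: "(nat \<Rightarrow> 'a::field mpoly) \<Rightarrow> nat \<Rightarrow> nat \<Rightarrow> 'a mpoly set" where
  "tower_ideal f i j = genideal (mpoly_ring i) (f ` {1..j})"

definition defines_tower :: "nat \<Rightarrow> (nat \<Rightarrow> 'a::field mpoly) \<Rightarrow> bool" where
  "defines_tower l f \<longleftrightarrow>
     (\<forall>i \<in> {1..l}.
        f i \<in> carrier (mpoly_ring i) \<and> monic_in i (f i) \<and>
        ring_irreducible\<^bsub>mpoly_ring i Quot tower_ideal f i (i - 1)\<^esub>
          (tower_ideal f i (i - 1) +>\<^bsub>mpoly_ring i\<^esub> f i))"

(* F_i = F[X_1, ..., X_i] / (f_1, ..., f_i) *)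

definition tower_field :: "(nat \<Rightarrow> 'a::field mpoly) \<Rightarrow> nat \<Rightarrow> 'a mpoly set ring" where
  "tower_field f i = mpoly_ring i Quot tower_ideal f i i"

(* The map F_(i-1) --> F_i induced by the inclusion of polynomial rings: the class C of g
   is sent to (f_1, ..., f_i) + C, which is the class of g in F_i. *)

definition tower_emb ::
  "(nat \<Rightarrow> 'a::field mpoly) \<Rightarrow> nat \<Rightarrow> 'a mpoly set \<Rightarrow> 'a mpoly set" where
  "tower_emb f i C = tower_ideal f i i <+>\<^bsub>mpoly_ring i\<^esub> C"

(* [L : K] = n for the field extension given by a (necessarily injective)
   homomorphism h : K --> L of fields *)

definition extension_degree ::
  "('b, 'm) ring_scheme \<Rightarrow> ('c, 'n) ring_scheme \<Rightarrow> ('b \<Rightarrow> 'c) \<Rightarrow> nat \<Rightarrow> bool" where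
  "extension_degree K L h n \<longleftrightarrow>
     field K \<and> field L \<and> h \<in> ring_hom K L \<and>
     ring.dimension L n (h ` carrier K) (carrier L)"

definition f_seq :: "nat \<Rightarrow> nat \<Rightarrow> 'a::field mpoly" where
  "f_seq p i =
     (if i = 1 then indet 1 ^ p - indet 1 - 1
      else indet i ^ p - indet i - (\<Prod>j = 1..i - 1. indet j) ^ (p - 1))"

end

theory Submission
  imports Defs "HOL-Algebra.Algebraic_Closure_Type"
begin

text \<open>Inside an algebraic closure of the field with \<open>p\<close> elements, choose successive roots \<open>x\<^sub>1, x\<^sub>2, \<dots>\<close> of
  \<open>x\<^sub>n\<^sub>+\<^sub>1\<^sup>p = x\<^sub>n\<^sub>+\<^sub>1 + a\<^sub>n\<close>, where \<open>a\<^sub>n = (x\<^sub>1 \<cdots> x\<^sub>n)^(p-1)\<close>. Let \<open>K\<^sub>n\<close> be the ring generated by \<open>x\<^sub>1, \<dots>, x\<^sub>n\<close> and put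
  \<open>q\<^sub>n = p^(p^n)\<close>.

  Artin-Schreier theory says that \<open>T^p - T - a\<^sub>n\<close> is irreducible over \<open>K\<^sub>n\<close> when the absolute trace of \<open>a\<^sub>n\<close> is not zero. This
  trace can be computed from the equations alone: it is \<open>(-1)^n\<close>, because along a single step of the tower
  the trace of \<open>x^(p-1)\<close> is \<open>-1\<close> (\<open>sum_translates_power\<close>, \<open>trace_sign_and_x_fixed\<close>). Concretely, the \<open>q\<^sub>n\<close>-power map fixes \<open>K\<^sub>n\<close>
  elementwise and sends \<open>x\<^sub>n\<^sub>+\<^sub>1\<close> to \<open>x\<^sub>n\<^sub>+\<^sub>1 + (-1)^n\<close>. A nonzero polynomial over \<open>K\<^sub>n\<close> with root \<open>x\<^sub>n\<^sub>+\<^sub>1\<close> therefore has the \<open>p\<close>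
  roots \<open>x\<^sub>n\<^sub>+\<^sub>1 + c\<close>, with \<open>c\<close> in the prime field, and its degree is at least \<open>p\<close> (\<open>degree_ge_if_root\<close>).

  The rest is transport. The lower bound for the degree and division by the monic polynomials \<open>f_seq p n\<close> show by induction
  that the evaluation \<open>X\<^sub>j \<mapsto> x\<^sub>j\<close> has the kernel \<open>tower_ideal (f_seq p) n n\<close>, and that the evaluation of all but the last
  indeterminate has the kernel \<open>tower_ideal (f_seq p) (Suc n) n\<close> (\<open>kernel_ev\<close>, \<open>kernel_psi\<close>). So the quotient rings of the
  tower are isomorphic to \<open>K\<^sub>n\<close> and to \<open>K\<^sub>n[T]\<close>, the class of \<open>f_seq p (Suc n)\<close> becomes \<open>T^p - T - a\<^sub>n\<close>, which is irreducible by the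
  lower bound (\<open>irreducible_psi_f_seq\<close>), and the powers of \<open>x\<^sub>n\<^sub>+\<^sub>1\<close> with exponents less than \<open>p\<close> form a basis of \<open>K\<^sub>n\<^sub>+\<^sub>1\<close> over \<open>K\<^sub>n\<close>
  (\<open>dimension_K\<close>).\<close>

section \<open>Power sums in characteristic p\<close>

lemma of_nat_power_CHAR:
  assumes "Factorial_Ring.prime p" "CHAR('b::comm_ring_1) = p"
  shows "(of_nat n :: 'b) ^ p = of_nat n"
proof (induction n)
  case 0
  show ?case using prime_gt_0_nat[OF assms(1)] by (simp add: power_0_left)
next
  case (Suc n)
  have "(of_nat (Suc n) :: 'b) ^ p = (1 + of_nat n) ^ p" by simp
  also have "\<dots> = 1 ^ p + of_nat n ^ p"
    by (rule freshmans_dream) (use assms in auto)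
  finally show ?case using Suc by simp
qed

lemma sum_periodic_shift:
  fixes h :: "nat \<Rightarrow> 'b::ab_group_add"
  assumes "\<And>n. h (n + p) = h n"
  shows "(\<Sum>c<p. h (d + c)) = (\<Sum>c<p. h c)"
proof (induction d)
  case (Suc d)
  have "h d + (\<Sum>c<p. h (Suc d + c)) = (\<Sum>c<Suc p. h (d + c))"
    by (subst sum.lessThan_Suc_shift) simp
  also have "\<dots> = (\<Sum>c<p. h (d + c)) + h d"
    using assms[of d] by simp
  finally show ?case using Suc by simp
qed simp

lemma inj_on_of_nat_mult:
  fixes t :: "'b::field"
  assumes "CHAR('b) = p" "t \<noteq> 0"
  shows "inj_on (\<lambda>c. x + of_nat c * t) {..<p}"
proof (rule linorder_inj_onI)
  fix c d assume cd: "c < d" "c \<in> {..<p}" "d \<in> {..<p}"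
  hence "\<not> p dvd d - c" by (auto dest: dvd_imp_le)
  thus "x + of_nat c * t \<noteq> x + of_nat d * t"
    using assms cd by (simp add: of_nat_eq_iff_char_dvd)
qed auto

text \<open>As a polynomial in \<open>x\<close>, the left-hand side plus \<open>1\<close> has degree less than \<open>p\<close>, so it vanishes
  identically once it vanishes at the \<open>p\<close> points \<open>d t\<close> with \<open>d < p\<close>. There the sum runs over the \<open>(p-1)\<close>-st
  powers of the elements of the prime field, which are \<open>0\<close> once and \<open>1\<close> otherwise. This is the trace of
  \<open>x^(p-1)\<close> along one step of the tower, where the conjugates of \<open>x\<close> are the elements \<open>x + c t\<close>.\<close>

lemma sum_translates_power:
  fixes x t :: "'b::field"
  assumes p: "Factorial_Ring.prime p" "CHAR('b) = p" and t: "t \<noteq> 0" "t ^ p = t"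
  shows "(\<Sum>c<p. (x + of_nat c * t) ^ (p - 1)) = -1"
proof -
  have p1: "p > 1" by (rule prime_gt_1_nat[OF p(1)])
  define h :: "nat \<Rightarrow> 'b" where "h n = (of_nat n * t) ^ (p - 1)" for n
  have h: "h n = (if n mod p = 0 then 0 else 1)" for n
  proof -
    have "(of_nat n * t) ^ p = of_nat n * t"
      using of_nat_power_CHAR[OF p] t by (simp add: power_mult_distrib)
    hence "(of_nat n * t) * h n = (of_nat n * t) * 1"
      using p1 by (simp add: h_def flip: power_Suc)
    moreover have "(of_nat n * t = 0) = (n mod p = 0)"
      using t p(2) by (simp add: of_nat_eq_0_iff_char_dvd dvd_eq_mod_eq_0)
    moreover have "h n = 0" if "of_nat n * t = 0"
      using that p1 by (simp add: h_def power_0_left)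
    ultimately show ?thesis by (metis mult_cancel_left)
  qed
  have "(\<Sum>c<p. h c) = (\<Sum>c\<in>{1..<p}. 1)"
    by (rule sum.mono_neutral_cong_right) (auto simp: h)
  also have "\<dots> = (-1 :: 'b)"
    using p1 p(2) of_nat_CHAR[where 'a='b] by simp
  finally have h_sum: "(\<Sum>c<p. h c) = -1" .
  define G where "G = (\<Sum>c<p. [: of_nat c * t, 1 :] ^ (p - 1)) + 1"
  have poly_G: "poly G y = (\<Sum>c<p. (y + of_nat c * t) ^ (p - 1)) + 1" for y
    by (simp add: G_def poly_sum add.commute)
  have deg: "Polynomial.degree G \<le> p - 1"
    unfolding G_def
    by (intro degree_add_le degree_sum_le) (auto intro: order.trans[OF degree_power_le])
  have root: "poly G (0 + of_nat d * t) = 0" for d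
  proof -
    have "poly G (0 + of_nat d * t) = (\<Sum>c<p. h (d + c)) + 1"
      by (simp add: poly_G h_def algebra_simps)
    also have "(\<Sum>c<p. h (d + c)) = (\<Sum>c<p. h c)"
      by (rule sum_periodic_shift) (simp add: h)
    finally show ?thesis by (simp add: h_sum)
  qed
  have "G = 0"
  proof (rule ccontr)
    assume "G \<noteq> 0"
    have "p = card ((\<lambda>d. 0 + of_nat d * t) ` {..<p})"
      using card_image[OF inj_on_of_nat_mult[OF p(2) t(1), of 0]] by (simp only: card_lessThan)
    also have "\<dots> \<le> card {y. poly G y = 0}"
      using root by (intro card_mono poly_roots_finite \<open>G \<noteq> 0\<close>) auto
    also have "\<dots> \<le> Polynomial.degree G"
      by (rule card_poly_roots_bound[OF \<open>G \<noteq> 0\<close>])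
    finally show False using deg p1 by simp
  qed
  thus ?thesis using poly_G[of x] by (simp add: eq_neg_iff_add_eq_0)
qed

text \<open>Translation by \<open>1\<close> permutes the field, so summing over all elements gives \<open>p = 0\<close>. The characteristic
  being \<open>p\<close>, the \<open>p\<close> multiples of \<open>1\<close> exhaust the field, and Frobenius fixes each of them.\<close>

lemma finite_prime_field:
  assumes p: "Factorial_Ring.prime p" and card: "card (UNIV :: 'a::field set) = p"
  shows "CHAR('a) = p" and "(a :: 'a) ^ p = a"
proof -
  have fin: "finite (UNIV :: 'a set)" using p card by (metis card.infinite not_prime_0)
  have "(\<Sum>y\<in>UNIV. y) = (\<Sum>y\<in>UNIV. y + 1 :: 'a)"
    by (rule sum.reindex_bij_witness[of _ "\<lambda>y. y + 1" "\<lambda>y. y - 1"]) auto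
  hence "of_nat p = (0 :: 'a)" by (simp add: sum.distrib card)
  hence "CHAR('a) dvd p" by (simp add: of_nat_eq_0_iff_char_dvd)
  thus char: "CHAR('a) = p" using p by (auto simp: prime_nat_iff)
  have "(\<lambda>c. 0 + of_nat c * (1 :: 'a)) ` {..<p} \<subseteq> range of_nat" by auto
  hence "card (range (\<lambda>n. of_nat n :: 'a)) \<ge> card ((\<lambda>c. 0 + of_nat c * (1 :: 'a)) ` {..<p})"
    by (intro card_mono finite_subset[OF subset_UNIV fin]) simp_all
  hence "card (range (\<lambda>n. of_nat n :: 'a)) \<ge> card (UNIV :: 'a set)"
    by (subst (asm) card_image[OF inj_on_of_nat_mult[OF char]]) (simp_all add: card)
  hence "range (\<lambda>n. of_nat n :: 'a) = UNIV" using fin by (intro card_seteq) auto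
  then obtain n where "a = of_nat n" by blast
  thus "a ^ p = a" using of_nat_power_CHAR[OF p char] by simp
qed

section \<open>Successive Artin-Schreier equations\<close>

text \<open>The constant term of the \<open>(n+1)\<close>-st Artin-Schreier equation, up to sign. For \<open>n = 0\<close> the empty product
  gives \<open>1\<close>, so that the first equation of the tower has the same form as the others. The ring is arbitrary because
  the formula is used both for indeterminates and for their values in a field.\<close>

definition as_const :: "nat \<Rightarrow> (nat \<Rightarrow> 'b::comm_ring_1) \<Rightarrow> nat \<Rightarrow> 'b" where
  "as_const p x i = (\<Prod>j = 1..i. x j) ^ (p - 1)"

text \<open>Successive roots of the equations in some field of characteristic \<open>p\<close>. Irreducibility is a consequence of
  these equations, through the traces that they determine.\<close>

locale artin_schreier_sequence =
  fixes p :: nat and x :: "nat \<Rightarrow> 'b::field"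
  assumes prime_p: "Factorial_Ring.prime p" and CHAR_p: "CHAR('b) = p"
    and x_Suc: "x (Suc n) ^ p = x (Suc n) + as_const p x n"
begin

text \<open>The number of elements that the \<open>n\<close>-th field of the tower is going to have.\<close>

abbreviation q :: "nat \<Rightarrow> nat" where "q n \<equiv> p ^ p ^ n"

lemma p_gt_1: "p > 1"
  by (rule prime_gt_1_nat[OF prime_p])

lemma frob_add: "(u + v :: 'b) ^ p ^ k = u ^ p ^ k + v ^ p ^ k"
  by (rule freshmans_dream') (use prime_p CHAR_p in auto)

lemma frob_sum: "(sum g S :: 'b) ^ p ^ k = (\<Sum>s\<in>S. g s ^ p ^ k)"
  by (rule freshmans_dream_sum') (use prime_p CHAR_p in auto)

lemma frob_uminus: "(- u :: 'b) ^ p ^ k = - (u ^ p ^ k)"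
  using frob_add[of u "-u" k] p_gt_1 by (simp add: eq_neg_iff_add_eq_0 add.commute power_0_left)

lemma frob_of_nat: "(of_nat m :: 'b) ^ p ^ k = of_nat m"
  using of_nat_power_CHAR[OF prime_p CHAR_p] by (induction k) (simp_all add: power_mult)

lemma frob_iterate_telescope:
  "x (Suc n) ^ p ^ m = x (Suc n) + (\<Sum>k<m. as_const p x n ^ p ^ k)"
proof (induction m)
  case (Suc m)
  have "x (Suc n) ^ p ^ Suc m = (x (Suc n) ^ p) ^ p ^ m"
    by (simp add: power_mult)
  also have "\<dots> = x (Suc n) ^ p ^ m + as_const p x n ^ p ^ m"
    by (simp add: x_Suc frob_add)
  finally show ?case by (simp add: Suc)
qed simp

text \<open>The translation \<open>t\<close> is fixed by the \<open>q n\<close>-power map, so iterating this map adds \<open>t\<close> once more each time.\<close>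

lemma frob_iterate_translate:
  assumes shift: "y ^ q n = y + t" and t: "t ^ p = t"
  shows "y ^ q n ^ c = (y :: 'b) + of_nat c * t"
proof (induction c)
  case (Suc c)
  have t': "t ^ p ^ k = t" for k using t by (induction k) (simp_all add: power_mult)
  have "y ^ q n ^ Suc c = (y ^ q n ^ c) ^ q n"
    by (simp add: mult.commute flip: power_mult)
  also have "\<dots> = y + t + of_nat c * t"
    by (simp add: Suc frob_add power_mult_distrib frob_of_nat t' shift)
  finally show ?case by (simp add: algebra_simps)
qed simp

lemma sign_frob: "((-1) ^ n :: 'b) ^ p = (-1) ^ n"
  using frob_uminus[of 1 1] by (metis mult.commute power_mult power_one power_one_right)

text \<open>The first sum is the absolute trace of \<open>as_const p x n\<close>; its not being zero is what makes the next equation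
  irreducible. Both claims are proved by one induction. By telescoping, \<open>x (Suc n) ^ q n\<close> is \<open>x (Suc n)\<close> plus the trace at
  stage \<open>n\<close>, that is, plus \<open>t = (-1)^n\<close>, and \<open>p\<close> such translations cancel. The trace at stage \<open>n + 1\<close> is computed by
  transitivity: the inner sum over the powers of the \<open>q n\<close>-power map is
  \<open>as_const p x n * (\<Sum>c<p. (x (Suc n) + c t)^(p-1)) = - as_const p x n\<close>, which changes the sign.\<close>

lemma trace_sign_and_x_fixed:
  "(\<Sum>k<p ^ n. as_const p x n ^ p ^ k) = (-1) ^ n \<and> (\<forall>j\<in>{1..n}. x j ^ q n = x j)"
proof (induction n)
  case 0
  show ?case by (simp add: as_const_def)
next
  case (Suc n)
  define t :: 'b where "t = (-1) ^ n"
  define b where "b = as_const p x (Suc n)"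
  have t: "t \<noteq> 0" "t ^ p = t" by (simp_all add: t_def sign_frob)
  have shift: "x (Suc n) ^ q n = x (Suc n) + t"
    using Suc by (simp add: frob_iterate_telescope t_def)
  have iter: "x (Suc n) ^ q n ^ c = x (Suc n) + of_nat c * t" for c
    by (rule frob_iterate_translate[OF shift t(2)])
  have q_Suc: "q (Suc n) = q n ^ p"
    by (simp add: mult.commute flip: power_mult)
  have fix_iter: "y ^ q n ^ c = y" if "y ^ q n = y" for y :: 'b and c
    using that by (induction c) (simp_all add: power_mult)
  have fixed: "x j ^ q (Suc n) = x j" if "j \<in> {1..Suc n}" for j
  proof (cases "j = Suc n")
    case True
    have "(of_nat p :: 'b) = 0" using CHAR_p of_nat_CHAR by blast
    thus ?thesis unfolding q_Suc True iter by simp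
  next
    case False
    thus ?thesis unfolding q_Suc using that Suc by (intro fix_iter) auto
  qed
  have a_fixed: "as_const p x n ^ q n = as_const p x n"
  proof -
    have "(\<Prod>j = 1..n. x j) ^ q n = (\<Prod>j = 1..n. x j)"
      using Suc by (simp add: prod_power_distrib)
    thus ?thesis unfolding as_const_def by (metis mult.commute power_mult)
  qed
  have b_eq: "b = as_const p x n * x (Suc n) ^ (p - 1)"
    by (simp add: b_def as_const_def power_mult_distrib)
  have b_iter: "b ^ q n ^ c = as_const p x n * (x (Suc n) + of_nat c * t) ^ (p - 1)" for c
  proof -
    have "b ^ q n ^ c = as_const p x n ^ q n ^ c * (x (Suc n) ^ q n ^ c) ^ (p - 1)"
      unfolding b_eq by (simp add: power_mult_distrib mult.commute flip: power_mult)
    thus ?thesis by (simp only: iter fix_iter[OF a_fixed])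
  qed
  \<comment> \<open>The relative trace of \<open>b\<close>, down to the previous stage.\<close>
  have inner: "(\<Sum>c<p. b ^ q n ^ c) = - as_const p x n"
    by (simp only: b_iter sum_translates_power[OF prime_p CHAR_p t] mult_minus_right mult_1_right
        flip: sum_distrib_left)
  \<comment> \<open>The exponents \<open>k < p^(n+1)\<close> are written as \<open>k + c p^n\<close> with \<open>k < p^n\<close> and \<open>c < p\<close>.\<close>
  have "(\<Sum>k<p ^ Suc n. b ^ p ^ k) = (\<Sum>k<p * p ^ n. b ^ p ^ k)"
    by simp
  also have "\<dots> = (\<Sum>c<p. \<Sum>k<p ^ n. b ^ p ^ (k + c * p ^ n))"
    by (subst sum.nat_group[symmetric]) (simp add: sum.atLeastLessThan_shift_0 atLeast0LessThan mult.commute add.commute)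
  also have "\<dots> = (\<Sum>k<p ^ n. \<Sum>c<p. (b ^ q n ^ c) ^ p ^ k)"
    by (subst sum.swap) (simp add: power_add power_mult mult.commute flip: power_mult)
  also have "\<dots> = (\<Sum>k<p ^ n. (- as_const p x n) ^ p ^ k)"
    by (simp only: inner flip: frob_sum)
  also have "\<dots> = (-1) ^ Suc n"
    using Suc by (simp add: frob_uminus sum_negf)
  finally show ?case using fixed unfolding b_def by blast
qed

lemma frob_x: "x (Suc n) ^ q n ^ c = x (Suc n) + of_nat c * (-1) ^ n"
proof (rule frob_iterate_translate)
  show "x (Suc n) ^ q n = x (Suc n) + (-1) ^ n"
    using trace_sign_and_x_fixed by (simp add: frob_iterate_telescope)
qed (rule sign_frob)

text \<open>The \<open>q n\<close>-power map fixes the coefficients of \<open>Q\<close>, hence maps roots to roots. As it translates \<open>x (Suc n)\<close> by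
  \<open>\<plusminus>1\<close>, one root already produces \<open>p\<close> different ones.\<close>

lemma degree_ge_if_root:
  assumes coeffs: "\<And>k. Polynomial.coeff Q k ^ q n = Polynomial.coeff Q k"
    and Q: "Q \<noteq> 0" "poly Q (x (Suc n)) = 0"
  shows "Polynomial.degree Q \<ge> p"
proof -
  have root: "poly Q (x (Suc n) ^ q n ^ c) = 0" for c
  proof (induction c)
    case (Suc c)
    define y where "y = x (Suc n) ^ q n ^ c"
    have "poly Q (y ^ q n) = poly Q y ^ q n"
      by (simp add: poly_altdef frob_sum power_mult_distrib coeffs mult.commute flip: power_mult)
    also have "\<dots> = 0" using Suc p_gt_1 by (simp add: y_def)
    finally show ?case by (simp add: y_def mult.commute flip: power_mult)
  qed (use Q in simp)
  let ?r = "\<lambda>c. x (Suc n) + of_nat c * (-1) ^ n"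
  have "p = card (?r ` {..<p})"
    by (subst card_image[OF inj_on_of_nat_mult[OF CHAR_p]]) auto
  also have "\<dots> \<le> card {y. poly Q y = 0}"
    using root by (intro card_mono poly_roots_finite Q) (auto simp: frob_x)
  also have "\<dots> \<le> Polynomial.degree Q"
    by (rule card_poly_roots_bound[OF Q(1)])
  finally show ?thesis .
qed

end

section \<open>Subrings of type-class rings as records\<close>

definition subring_set :: "'c::comm_ring_1 set \<Rightarrow> bool" where
  "subring_set S \<longleftrightarrow> 1 \<in> S \<and> (\<forall>a\<in>S. \<forall>b\<in>S. a - b \<in> S \<and> a * b \<in> S)"

text \<open>A subring of a type-class ring, presented as a record. The operations are those of the ambient type, so that
  type-class arithmetic remains available for computing in it.\<close>

definition ring_on :: "'c::comm_ring_1 set \<Rightarrow> 'c ring" where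
  "ring_on S = \<lparr>carrier = S, monoid.mult = (*), one = 1, ring.zero = 0, add = (+)\<rparr>"

lemma ring_on_simps [simp]:
  "carrier (ring_on S) = S" "a \<otimes>\<^bsub>ring_on S\<^esub> b = a * b" "a \<oplus>\<^bsub>ring_on S\<^esub> b = a + b"
  "\<one>\<^bsub>ring_on S\<^esub> = 1" "\<zero>\<^bsub>ring_on S\<^esub> = 0"
  by (simp_all add: ring_on_def)

context
  fixes S :: "'c::comm_ring_1 set"
  assumes S: "subring_set S"
begin

lemma subring_set_one: "1 \<in> S"
  and subring_set_diff: "a \<in> S \<Longrightarrow> b \<in> S \<Longrightarrow> a - b \<in> S"
  and subring_set_mult: "a \<in> S \<Longrightarrow> b \<in> S \<Longrightarrow> a * b \<in> S"
  using S by (auto simp: subring_set_def)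

lemma subring_set_zero: "0 \<in> S"
  using subring_set_diff[OF subring_set_one subring_set_one] by simp

lemma subring_set_uminus: "a \<in> S \<Longrightarrow> - a \<in> S"
  using subring_set_diff[OF subring_set_zero, of a] by simp

lemma subring_set_add: "a \<in> S \<Longrightarrow> b \<in> S \<Longrightarrow> a + b \<in> S"
  using subring_set_diff[of a "- b"] subring_set_uminus[of b] by simp

lemma subring_set_sum: "(\<And>i. i \<in> I \<Longrightarrow> g i \<in> S) \<Longrightarrow> sum g I \<in> S"
  by (induction I rule: infinite_finite_induct) (auto intro: subring_set_zero subring_set_add)

lemma subring_set_prod: "(\<And>i. i \<in> I \<Longrightarrow> g i \<in> S) \<Longrightarrow> prod g I \<in> S"
  by (induction I rule: infinite_finite_induct) (auto intro: subring_set_one subring_set_mult)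

lemma subring_set_power: "a \<in> S \<Longrightarrow> a ^ n \<in> S"
  by (induction n) (auto intro: subring_set_one subring_set_mult)

lemma ring_on_cring: "cring (ring_on S)"
proof (rule cringI)
  show "abelian_group (ring_on S)"
  proof (rule abelian_groupI)
    fix a assume "a \<in> carrier (ring_on S)"
    thus "\<exists>b\<in>carrier (ring_on S). b \<oplus>\<^bsub>ring_on S\<^esub> a = \<zero>\<^bsub>ring_on S\<^esub>"
      by (intro bexI[of _ "- a"]) (auto intro: subring_set_uminus)
  qed (auto intro: subring_set_zero subring_set_add)
  show "Group.comm_monoid (ring_on S)"
    by (rule comm_monoidI) (auto intro: subring_set_one subring_set_mult)
qed (auto simp: algebra_simps)

lemma ring_on_ring: "ring (ring_on S)"
  using ring_on_cring by (rule cring.axioms(1))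

lemma ring_on_a_inv: "a \<in> S \<Longrightarrow> \<ominus>\<^bsub>ring_on S\<^esub> a = - a"
  using abelian_group.minus_equality[OF ring.is_abelian_group[OF ring_on_ring], of "- a" a]
  by (auto intro: subring_set_uminus)

lemma ring_on_idealI:
  assumes "I \<subseteq> S" "0 \<in> I" "\<And>a b. a \<in> I \<Longrightarrow> b \<in> I \<Longrightarrow> a + b \<in> I"
    "\<And>a s. a \<in> I \<Longrightarrow> s \<in> S \<Longrightarrow> s * a \<in> I"
  shows "ideal I (ring_on S)"
proof (rule idealI)
  have uminus: "- a \<in> I" if "a \<in> I" for a
    using assms(4)[OF that, of "- 1"] subring_set_one subring_set_uminus by simp
  show "subgroup I (add_monoid (ring_on S))"
  proof (rule group.subgroupI)
    show "Group.group (add_monoid (ring_on S))"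
      using abelian_group.a_group[OF ring.is_abelian_group[OF ring_on_ring]] .
    show "inv\<^bsub>add_monoid (ring_on S)\<^esub> a \<in> I" if "a \<in> I" for a
      using that uminus ring_on_a_inv[of a] assms(1) by (auto simp: a_inv_def)
  qed (use assms in auto)
qed (use assms ring_on_ring in \<open>auto simp: mult.commute\<close>)

end

lemma ring_on_idealE:
  assumes "ideal I (ring_on S)"
  shows "I \<subseteq> S" "0 \<in> I" "\<And>a b. a \<in> I \<Longrightarrow> b \<in> I \<Longrightarrow> a + b \<in> I"
    "\<And>a s. a \<in> I \<Longrightarrow> s \<in> S \<Longrightarrow> s * a \<in> I"
proof -
  interpret ideal I "ring_on S" by fact
  show "I \<subseteq> S" "0 \<in> I" using a_subset additive_subgroup.zero_closed[OF is_additive_subgroup] by auto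
  show "\<And>a b. a \<in> I \<Longrightarrow> b \<in> I \<Longrightarrow> a + b \<in> I" using additive_subgroup.a_closed[OF is_additive_subgroup] by simp
  show "\<And>a s. a \<in> I \<Longrightarrow> s \<in> S \<Longrightarrow> s * a \<in> I" using I_l_closed by simp
qed

lemma ring_on_ideal_sum:
  assumes "ideal I (ring_on S)" "\<And>k. k \<in> M \<Longrightarrow> g k \<in> I"
  shows "sum g M \<in> I"
  using assms(2) by (induction M rule: infinite_finite_induct)
    (auto intro: ring_on_idealE(2,3)[OF assms(1)])

lemma ring_on_field:
  fixes S :: "'c::field set"
  assumes S: "subring_set S" and inv: "\<And>a. a \<in> S \<Longrightarrow> inverse a \<in> S"
  shows "field (ring_on S)"
proof -
  interpret cring "ring_on S" by (rule ring_on_cring[OF S])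
  show ?thesis
  proof (rule cring_fieldI2)
    show "\<exists>b\<in>carrier (ring_on S). a \<otimes>\<^bsub>ring_on S\<^esub> b = \<one>\<^bsub>ring_on S\<^esub>"
      if "a \<in> carrier (ring_on S)" "a \<noteq> \<zero>\<^bsub>ring_on S\<^esub>" for a
      using that by (intro bexI[of _ "inverse a"]) (auto intro: inv)
  qed simp
qed

lemma ring_on_domain:
  fixes S :: "'c::idom set"
  assumes "subring_set S"
  shows "domain (ring_on S)"
  by (intro domainI ring_on_cring assms) auto

lemma ring_on_Units:
  "a \<in> Units (ring_on S) \<longleftrightarrow> a \<in> S \<and> (\<exists>b\<in>S. a * b = 1)"
  by (auto simp: Units_def mult.commute)

lemma subfield_ring_on:
  fixes S T :: "'c::field set"
  assumes S: "subring_set S" "\<And>a. a \<in> S \<Longrightarrow> inverse a \<in> S"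
    and T: "subring_set T" "\<And>a. a \<in> T \<Longrightarrow> inverse a \<in> T" and sub: "S \<subseteq> T"
  shows "subfield S (ring_on T)"
proof -
  interpret T: field "ring_on T" by (rule ring_on_field[OF T])
  have inv: "inv\<^bsub>ring_on T\<^esub> a = inverse a" if "a \<in> S - {0}" for a
    using that sub T(2) by (intro T.comm_inv_char) auto
  show ?thesis
  proof (rule T.subfieldI')
    show "subring S (ring_on T)"
      using sub by (intro T.subringI)
        (auto simp: ring_on_a_inv[OF T(1)] subset_iff
          intro: subring_set_one[OF S(1)] subring_set_uminus[OF S(1)]
            subring_set_mult[OF S(1)] subring_set_add[OF S(1)])
  qed (use inv S(2) in auto)
qed

text \<open>The offset \<open>m\<close> serves the induction on the list of powers only: linear combinations of powers are values of polynomials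
  with the list as coefficient list.\<close>

lemma combine_powers:
  assumes "subring_set T" 
  shows "ring.combine (ring_on T) Ks (map (\<lambda>k. y ^ (k + m)) [0..<n]) = y ^ m * poly (Poly (take n Ks)) y"
proof -
  interpret T: ring "ring_on T" by (rule ring_on_ring[OF assms])
  show ?thesis
  proof (induction n arbitrary: Ks m)
    case (Suc n)
    have upt: "map (\<lambda>k. y ^ (k + m)) [0..<Suc n] = y ^ m # map (\<lambda>k. y ^ (k + Suc m)) [0..<n]"
      by (simp add: map_upt_Suc del: upt_Suc)
    show ?case
    proof (cases Ks)
      case (Cons k Ks')
      show ?thesis
        unfolding upt Cons T.combine.simps Suc.IH by (simp add: algebra_simps)
    qed simp
  qed simp
qed

section \<open>Transport along ring isomorphisms\<close>

lemma ring_iso_irreducible: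
  assumes h: "h \<in> ring_iso A B" and rings: "ring A" "ring B" and a: "a \<in> carrier A"
    and irr: "ring_irreducible\<^bsub>B\<^esub> (h a)"
  shows "ring_irreducible\<^bsub>A\<^esub> a"
proof -
  interpret A: ring A by fact
  interpret B: ring B by fact
  note hE = ring_iso_memE[OF h]
  have inj: "u = v" if "h u = h v" "u \<in> carrier A" "v \<in> carrier A" for u v
    using hE(5) that by (auto simp: bij_betw_def inj_on_def)
  have surj: "\<exists>u\<in>carrier A. v = h u" if "v \<in> carrier B" for v
    using hE(5) that by (auto simp: bij_betw_def)
  have Units: "u \<in> Units A \<longleftrightarrow> h u \<in> Units B" if u: "u \<in> carrier A" for u
  proof
    assume "u \<in> Units A"
    then obtain v where v: "v \<in> carrier A" "v \<otimes>\<^bsub>A\<^esub> u = \<one>\<^bsub>A\<^esub>" "u \<otimes>\<^bsub>A\<^esub> v = \<one>\<^bsub>A\<^esub>"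
      by (auto simp: Units_def)
    hence "h v \<otimes>\<^bsub>B\<^esub> h u = \<one>\<^bsub>B\<^esub>" "h u \<otimes>\<^bsub>B\<^esub> h v = \<one>\<^bsub>B\<^esub>"
      using u by (simp_all add: hE(4) flip: hE(2))
    thus "h u \<in> Units B" using u v hE(1) by (auto simp: Units_def)
  next
    assume "h u \<in> Units B"
    then obtain w where w: "w \<in> carrier B" "w \<otimes>\<^bsub>B\<^esub> h u = \<one>\<^bsub>B\<^esub>" "h u \<otimes>\<^bsub>B\<^esub> w = \<one>\<^bsub>B\<^esub>"
      by (auto simp: Units_def)
    obtain v where v: "v \<in> carrier A" "w = h v" using surj[OF w(1)] by blast
    have "v \<otimes>\<^bsub>A\<^esub> u = \<one>\<^bsub>A\<^esub>" "u \<otimes>\<^bsub>A\<^esub> v = \<one>\<^bsub>A\<^esub>"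
      using w(2,3) u v by (auto intro!: inj simp: hE(2,4))
    thus "u \<in> Units A" using u v by (auto simp: Units_def)
  qed
  have divides: "b divides\<^bsub>A\<^esub> c \<longleftrightarrow> h b divides\<^bsub>B\<^esub> h c" if bc: "b \<in> carrier A" "c \<in> carrier A" for b c
  proof
    assume "b divides\<^bsub>A\<^esub> c"
    thus "h b divides\<^bsub>B\<^esub> h c" using bc hE(1,2) by (auto simp: factor_def)
  next
    assume "h b divides\<^bsub>B\<^esub> h c"
    then obtain w where w: "w \<in> carrier B" "h c = h b \<otimes>\<^bsub>B\<^esub> w" by (auto simp: factor_def)
    obtain v where v: "v \<in> carrier A" "w = h v" using surj[OF w(1)] by blast
    have "c = b \<otimes>\<^bsub>A\<^esub> v" using w(2) bc v by (intro inj) (simp_all add: hE(2))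
    thus "b divides\<^bsub>A\<^esub> c" using v by (auto simp: factor_def)
  qed
  have "h \<in> ring_hom A B" using h by (simp add: ring_iso_def)
  hence "h \<zero>\<^bsub>A\<^esub> = \<zero>\<^bsub>B\<^esub>" using rings by (rule ring_hom_zero)
  hence "a \<noteq> \<zero>\<^bsub>A\<^esub>" using irr by (auto simp: ring_irreducible_def)
  moreover have "irreducible A a"
  proof (rule irreducibleI)
    show "a \<notin> Units A" using irr Units[OF a] by (auto simp: ring_irreducible_def irreducible_def)
    fix b assume b: "b \<in> carrier A" "properfactor A b a"
    hence "properfactor B (h b) (h a)" using divides a by (auto simp: properfactor_def)
    thus "b \<in> Units A"
      using irr Units[OF b(1)] hE(1)[OF b(1)] by (auto simp: ring_irreducible_def irreducible_def)
  qed
  ultimately show ?thesis by (simp add: ring_irreducible_def)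
qed

lemma ring_iso_field:
  assumes h: "h \<in> ring_iso A B" and "ring A" "field B"
  shows "field A"
proof -
  interpret B: field B by fact
  have inv: "inv_into (carrier A) h \<in> ring_iso B A"
    using h assms(2) by (simp add: ring_iso_set_sym)
  moreover have "inv_into (carrier A) h \<zero>\<^bsub>B\<^esub> = \<zero>\<^bsub>A\<^esub>"
    using ring_hom_zero[OF _ B.ring_axioms assms(2)] inv by (auto simp: ring_iso_def)
  ultimately show ?thesis
    using B.ring_iso_imp_img_field[OF inv] by simp
qed

text \<open>The degree of an embedding \<open>h\<close> may be computed in any concrete model \<open>A' \<subseteq> B'\<close> of it: the isomorphisms \<open>a\<close> and \<open>b\<close>
  turn \<open>h\<close> into the inclusion.\<close>

lemma extension_degree_transfer:
  assumes A: "a \<in> ring_iso A A'" "ring A" "field A'" and B: "b \<in> ring_iso B B'" "ring B" "field B'"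
    and h: "\<And>u. u \<in> carrier A \<Longrightarrow> h u \<in> carrier B \<and> b (h u) = a u"
    and ops: "\<And>u v. u \<in> carrier A' \<Longrightarrow> v \<in> carrier A' \<Longrightarrow> u \<otimes>\<^bsub>A'\<^esub> v = u \<otimes>\<^bsub>B'\<^esub> v"
      "\<And>u v. u \<in> carrier A' \<Longrightarrow> v \<in> carrier A' \<Longrightarrow> u \<oplus>\<^bsub>A'\<^esub> v = u \<oplus>\<^bsub>B'\<^esub> v"
      "\<one>\<^bsub>A'\<^esub> = \<one>\<^bsub>B'\<^esub>"
    and sub: "subfield (carrier A') B'"
    and dim: "ring.dimension B' n (carrier A') (carrier B')"
  shows "extension_degree A B h n"
proof -
  interpret A: ring A by fact
  interpret B: ring B by fact
  interpret B': field B' by fact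
  note aE = ring_iso_memE[OF A(1)] and bE = ring_iso_memE[OF B(1)]
  have inj: "u = v" if "b u = b v" "u \<in> carrier B" "v \<in> carrier B" for u v
    using bE(5) that by (auto simp: bij_betw_def inj_on_def)
  define e where "e = inv_into (carrier B) b"
  have e_iso: "e \<in> ring_iso B' B"
    using B(1,2) by (simp add: ring_iso_set_sym e_def)
  have e_b: "e (b u) = u" if "u \<in> carrier B" for u
    using bE(5) that by (simp add: e_def bij_betw_def)
  interpret e: ring_hom_ring B' B e
    using e_iso by (intro ring_hom_ringI2) (auto simp: ring_iso_def B'.ring_axioms B.ring_axioms)
  have fields: "field A" "field B"
    using ring_iso_field A B by blast+
  have hom: "h \<in> ring_hom A B"
  proof (rule ring_hom_memI)
    fix u v assume uv: "u \<in> carrier A" "v \<in> carrier A"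
    show "h (u \<otimes>\<^bsub>A\<^esub> v) = h u \<otimes>\<^bsub>B\<^esub> h v"
      by (rule inj) (use uv h in \<open>auto simp: bE(2) aE(1,2) ops(1)\<close>)
    show "h (u \<oplus>\<^bsub>A\<^esub> v) = h u \<oplus>\<^bsub>B\<^esub> h v"
      by (rule inj) (use uv h in \<open>auto simp: bE(3) aE(1,3) ops(2)\<close>)
  next
    show "h \<one>\<^bsub>A\<^esub> = \<one>\<^bsub>B\<^esub>"
      by (rule inj) (use h in \<open>auto simp: bE(4) aE(4) ops(3)\<close>)
  qed (use h in auto)
  have "h u = e (a u)" if "u \<in> carrier A" for u
    using e_b[of "h u"] h[OF that] by simp
  hence "h ` carrier A = e ` a ` carrier A" unfolding image_image by (intro image_cong) auto
  also have "a ` carrier A = carrier A'" using aE(5) by (simp add: bij_betw_def)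
  finally have img_h: "h ` carrier A = e ` carrier A'" .
  have bij_e: "bij_betw e (carrier B') (carrier B)" using ring_iso_memE(5)[OF e_iso] .
  have "B.dimension n (e ` carrier A') (e ` carrier B')"
    by (rule e.inj_hom_dimension[OF sub _ _ dim])
      (use bij_e field.is_ring[OF fields(2)] domain.one_not_zero[OF field.axioms(1)[OF fields(2)]]
        in \<open>auto simp: bij_betw_def\<close>)
  moreover have "e ` carrier B' = carrier B" using bij_e by (simp add: bij_betw_def)
  ultimately show ?thesis
    using fields hom img_h by (simp add: extension_degree_def)
qed

section \<open>Polynomials over a subring\<close>

text \<open>The polynomial ring over a subring \<open>S\<close>, inside the polynomials over the ambient ring.\<close>

definition polys_over :: "'c::comm_ring_1 set \<Rightarrow> 'c poly set" where
  "polys_over S = {P. \<forall>k. Polynomial.coeff P k \<in> S}"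

lemma subring_set_polys_over:
  assumes S: "subring_set S"
  shows "subring_set (polys_over S)"
  using S unfolding subring_set_def polys_over_def
  by (auto simp: coeff_mult coeff_1 subring_set_zero[OF S] intro!: subring_set_sum[OF S])

lemma polys_over_monom:
  assumes "subring_set S" "a \<in> S"
  shows "Polynomial.monom a n \<in> polys_over S"
  using assms subring_set_zero by (auto simp: polys_over_def)

lemma polys_over_const:
  assumes "subring_set S"
  shows "[:a:] \<in> polys_over S \<longleftrightarrow> a \<in> S"
  using subring_set_zero[OF assms]
  by (auto simp: polys_over_def coeff_pCons split: nat.splits dest: spec[of _ 0])

text \<open>Long division by a monic polynomial uses ring operations on the coefficients only, so it stays over the subring.\<close>

lemma monic_division_polys_over:
  assumes S: "subring_set S" and F: "F \<in> polys_over S" "Polynomial.lead_coeff F = 1"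
      "Polynomial.degree F > 0"
    and P: "P \<in> polys_over S"
  shows "\<exists>Q\<in>polys_over S. \<exists>R\<in>polys_over S. P = F * Q + R \<and> Polynomial.degree R < Polynomial.degree F"
  using P
proof (induction "Polynomial.degree P" arbitrary: P rule: less_induct)
  case less
  note SP = subring_set_polys_over[OF S]
  show ?case
  proof (cases "Polynomial.degree P < Polynomial.degree F")
    case True
    thus ?thesis using less.prems subring_set_zero[OF SP]
      by (intro bexI[of _ 0] bexI[of _ P]) auto
  next
    case False
    \<comment> \<open>One step of long division: \<open>F * M\<close> has the leading term of \<open>P\<close>.\<close>
    define M where "M = Polynomial.monom (Polynomial.lead_coeff P) (Polynomial.degree P - Polynomial.degree F)"
    define P' where "P' = P - F * M"
    have M: "M \<in> polys_over S"
      unfolding M_def using less.prems by (intro polys_over_monom[OF S]) (simp add: polys_over_def)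
    have P': "P' \<in> polys_over S"
      unfolding P'_def by (intro subring_set_diff[OF SP] subring_set_mult[OF SP] less.prems F M)
    have "Polynomial.degree (F * M) \<le> Polynomial.degree F + (Polynomial.degree P - Polynomial.degree F)"
      unfolding M_def by (intro order.trans[OF degree_mult_le] add_left_mono degree_monom_le)
    hence "Polynomial.degree P' \<le> Polynomial.degree P"
      unfolding P'_def using False by (intro degree_diff_le) auto
    moreover have "Polynomial.coeff P' (Polynomial.degree P) = 0"
      using False F(2) by (simp add: P'_def M_def coeff_monom_mult mult.commute[of F])
    ultimately have "Polynomial.degree P' < Polynomial.degree P"
      using eq_zero_or_degree_less[of P' "Polynomial.degree P"] False F(3) by auto
    from less.hyps[OF this P'] obtain Q R where QR: "Q \<in> polys_over S" "R \<in> polys_over S"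
      "P' = F * Q + R" "Polynomial.degree R < Polynomial.degree F" by blast
    have "P = F * (Q + M) + R"
      using QR(3) by (simp add: P'_def algebra_simps)
    thus ?thesis using QR subring_set_add[OF SP QR(1) M] by blast
  qed
qed

lemma subring_set_polyval:
  assumes S: "subring_set S" and P: "P \<in> polys_over S" and y: "y \<in> S"
  shows "poly P y \<in> S"
  unfolding poly_altdef using P
  by (intro subring_set_sum subring_set_mult subring_set_power S y) (simp add: polys_over_def)

lemma polys_over_mono: "S \<subseteq> T \<Longrightarrow> polys_over S \<subseteq> polys_over T"
  by (auto simp: polys_over_def)

lemma poly_map_const_X: "poly (map_poly (\<lambda>a. [:a:]) P) [:0, 1:] = (P :: 'c::comm_ring_1 poly)"
  by (induction P) (simp_all add: map_poly_pCons)

text \<open>The Artin-Schreier polynomial \<open>T^p - T - a\<close>.\<close>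

definition as_poly :: "nat \<Rightarrow> 'c::comm_ring_1 \<Rightarrow> 'c poly" where
  "as_poly p a = Polynomial.monom 1 p - Polynomial.monom 1 1 - [:a:]"

lemma degree_as_poly:
  assumes "p > 1"
  shows "Polynomial.degree (as_poly p (a::'c::comm_ring_1)) = p" "Polynomial.coeff (as_poly p a) p = 1"
proof -
  show top: "Polynomial.coeff (as_poly p a) p = 1"
    using assms by (simp add: as_poly_def coeff_pCons split: nat.split)
  have "Polynomial.degree (as_poly p a) \<le> p"
    unfolding as_poly_def
    by (intro degree_diff_le) (use assms in \<open>auto intro: order.trans[OF degree_monom_le]\<close>)
  with top show "Polynomial.degree (as_poly p a) = p" by (intro antisym le_degree) auto
qed

lemma poly_as_poly: "poly (as_poly p a) y = y ^ p - y - a"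
  by (simp add: as_poly_def poly_monom)

lemma as_poly_in_polys_over:
  assumes "subring_set S" "a \<in> S"
  shows "as_poly p a \<in> polys_over S"
  unfolding as_poly_def using assms
  by (intro subring_set_diff subring_set_polys_over polys_over_monom subring_set_one)
    (simp_all add: polys_over_const)

text \<open>Over an algebraically closed field the equations can be solved one after the other. The recursion is carried out on
  the products \<open>P n\<close> of the roots found so far, since they determine the next equation.\<close>

lemma artin_schreier_sequence_exists:
  "\<exists>x :: nat \<Rightarrow> 'b::alg_closed_field. \<forall>n. x (Suc n) ^ p = x (Suc n) + as_const p x n" if p: "p > 1"
proof -
  have "\<exists>r :: 'b. r ^ p - r = a" for a
  proof -
    have "\<exists>r. poly (as_poly p a) r = 0"
      using degree_as_poly(1)[OF p, of a] p by (intro alg_closed_imp_poly_has_root) simp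
    thus ?thesis by (simp add: poly_as_poly)
  qed
  then obtain root :: "'b \<Rightarrow> 'b" where root: "root a ^ p = root a + a" for a
    by (metis diff_add_cancel add.commute)
  define P where "P = rec_nat 1 (\<lambda>_ y. y * root (y ^ (p - 1)))"
  define x where "x j = root (P (j - 1) ^ (p - 1))" for j
  have P: "P n = (\<Prod>j = 1..n. x j)" for n
    by (induction n) (simp_all add: P_def x_def mult.commute)
  have "x (Suc n) ^ p = x (Suc n) + as_const p x n" for n
    unfolding as_const_def P[symmetric] by (simp add: x_def root)
  thus ?thesis by (intro exI[of _ x] allI)
qed

section \<open>Evaluation of multivariate polynomials\<close>

text \<open>Evaluation at an arbitrary point of a commutative ring, with the coefficients sent there by \<open>c\<close>. The target is kept
  general because it will be both a field and a univariate polynomial ring.\<close>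

definition eval_mpoly :: "('a::comm_ring_1 \<Rightarrow> 'c::comm_ring_1) \<Rightarrow> (nat \<Rightarrow> 'c) \<Rightarrow> 'a mpoly \<Rightarrow> 'c" where
  "eval_mpoly c v g = (\<Sum>m\<in>Poly_Mapping.keys g.
     c (Poly_Mapping.lookup g m) * (\<Prod>j\<in>Poly_Mapping.keys m. v j ^ Poly_Mapping.lookup m j))"

lemma poly_mapping_monomial_induct:
  fixes g :: "'k \<Rightarrow>\<^sub>0 'b::comm_monoid_add"
  assumes "P 0" "\<And>m. m \<in> Poly_Mapping.keys g \<Longrightarrow> P (Poly_Mapping.single m (Poly_Mapping.lookup g m))"
    "\<And>g h. P g \<Longrightarrow> P h \<Longrightarrow> P (g + h)"
  shows "P g"
proof -
  have "g = (\<Sum>m\<in>Poly_Mapping.keys g. Poly_Mapping.single m (Poly_Mapping.lookup g m))"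
    by (rule poly_mapping_eqI)
      (auto simp: lookup_sum lookup_single when_def not_in_keys_iff_lookup_eq_zero)
  moreover have "P (\<Sum>m\<in>M. Poly_Mapping.single m (Poly_Mapping.lookup g m))"
    if "M \<subseteq> Poly_Mapping.keys g" for M
    using finite_subset[OF that finite_keys] that
    by (induction M rule: finite_induct) (auto intro: assms)
  ultimately show ?thesis by (metis order_refl)
qed

locale comm_ring_hom =
  fixes c :: "'a::comm_ring_1 \<Rightarrow> 'c::comm_ring_1"
  assumes hom_add: "c (a + b) = c a + c b" and hom_mult: "c (a * b) = c a * c b" and hom_one: "c 1 = 1"
begin

lemma hom_zero: "c 0 = 0"
  using hom_add[of 0 0] by simp

lemma hom_uminus: "c (- a) = - c a"
  using hom_add[of a "- a"] by (simp add: hom_zero eq_neg_iff_add_eq_0 add.commute)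

lemma hom_diff: "c (a - b) = c a - c b"
  using hom_add[of a "- b"] by (simp add: hom_uminus)

lemma hom_sum: "c (sum g I) = (\<Sum>i\<in>I. c (g i))"
  by (induction I rule: infinite_finite_induct) (auto simp: hom_zero hom_add)

lemma hom_prod: "c (prod g I) = (\<Prod>i\<in>I. c (g i))"
  by (induction I rule: infinite_finite_induct) (auto simp: hom_one hom_mult)

lemma hom_power: "c (a ^ n) = c a ^ n"
  by (induction n) (auto simp: hom_one hom_mult)

lemma hom_poly: "c (poly P y) = poly (map_poly c P) (c y)"
proof -
  have "c (poly P y) = (\<Sum>k\<le>Polynomial.degree P. c (Polynomial.coeff P k) * c y ^ k)"
    by (simp add: poly_altdef hom_sum hom_mult hom_power)
  also have "\<dots> = (\<Sum>k\<le>Polynomial.degree P. poly (Polynomial.monom (Polynomial.coeff (map_poly c P) k) k) (c y))"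
    by (simp add: poly_monom coeff_map_poly hom_zero)
  also have "\<dots> = poly (map_poly c P) (c y)"
    by (subst poly_sum[symmetric], subst poly_as_sum_of_monoms')
      (auto intro: degree_le simp: coeff_map_poly hom_zero coeff_eq_0)
  finally show ?thesis .
qed

lemma eval_mpoly_single:
  "eval_mpoly c v (Poly_Mapping.single m a) = c a * (\<Prod>j\<in>Poly_Mapping.keys m. v j ^ Poly_Mapping.lookup m j)"
  by (simp add: eval_mpoly_def hom_zero)

lemma eval_mpoly_add: "eval_mpoly c v (g + h) = eval_mpoly c v g + eval_mpoly c v h"
  unfolding eval_mpoly_def
  by (rule setsum_keys_plus_distrib) (simp_all add: hom_zero hom_add algebra_simps)

lemma monomial_value_add:
  "(\<Prod>j\<in>Poly_Mapping.keys (m + n). v j ^ Poly_Mapping.lookup (m + n) j) =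
   (\<Prod>j\<in>Poly_Mapping.keys m. v j ^ Poly_Mapping.lookup m j) *
   (\<Prod>j\<in>Poly_Mapping.keys n. (v j :: 'c) ^ Poly_Mapping.lookup n j)"
proof -
  let ?U = "Poly_Mapping.keys m \<union> Poly_Mapping.keys n"
  have *: "(\<Prod>j\<in>Poly_Mapping.keys k. v j ^ Poly_Mapping.lookup k j) = (\<Prod>j\<in>?U. v j ^ Poly_Mapping.lookup k j)"
    if "Poly_Mapping.keys k \<subseteq> ?U" for k
    using that by (intro prod.mono_neutral_left) (auto simp: in_keys_iff)
  show ?thesis
    unfolding *[OF keys_add] *[OF Un_upper1] *[OF Un_upper2]
    by (simp only: lookup_add power_add prod.distrib)
qed

lemma eval_mpoly_mult: "eval_mpoly c v (g * h) = eval_mpoly c v g * eval_mpoly c v h"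
proof -
  have zero: "eval_mpoly c v 0 = 0" by (simp add: eval_mpoly_def)
  show ?thesis
  proof (induction g rule: poly_mapping_monomial_induct)
    case (2 m)
    show ?case
      by (induction h rule: poly_mapping_monomial_induct)
        (simp_all add: zero mult_single eval_mpoly_single monomial_value_add hom_mult
          eval_mpoly_add algebra_simps)
  qed (simp_all add: zero eval_mpoly_add algebra_simps)
qed

lemma eval_mpoly_hom: "comm_ring_hom (eval_mpoly c v)"
proof
  show "eval_mpoly c v 1 = 1" using eval_mpoly_single[of v 0 1] by (simp add: hom_one)
qed (simp_all add: eval_mpoly_add eval_mpoly_mult)

lemma eval_mpoly_indet: "eval_mpoly c v (indet j) = v j"
  by (simp add: indet_def eval_mpoly_single hom_one)

lemma subring_set_image:
  assumes "subring_set S"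
  shows "subring_set (c ` S)"
  unfolding subring_set_def
proof (intro conjI ballI)
  show "1 \<in> c ` S" using hom_one subring_set_one[OF assms] by (metis imageI)
  fix a b assume "a \<in> c ` S" "b \<in> c ` S"
  then obtain a' b' where "a = c a'" "b = c b'" "a' \<in> S" "b' \<in> S" by blast
  thus "a - b \<in> c ` S" "a * b \<in> c ` S"
    using subring_set_diff[OF assms] subring_set_mult[OF assms]
    by (auto simp flip: hom_diff hom_mult)
qed

lemma ring_on_image_hom:
  assumes "subring_set S"
  shows "ring_hom_ring (ring_on S) (ring_on (c ` S)) c"
  using ring_on_ring[OF assms] ring_on_ring[OF subring_set_image[OF assms]]
  by (rule ring_hom_ringI) (auto simp: hom_add hom_mult hom_one)

end

lemma comm_ring_hom_const_poly:
  assumes "comm_ring_hom c"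
  shows "comm_ring_hom (\<lambda>a. [:c a:])"
proof -
  interpret comm_ring_hom c by fact
  show ?thesis by standard (simp_all add: hom_add hom_mult hom_one)
qed

section \<open>The rings and ideals of the tower\<close>

definition mpoly_carrier :: "nat \<Rightarrow> 'a::field mpoly set" where
  "mpoly_carrier i = {g. \<forall>m \<in> Poly_Mapping.keys g. Poly_Mapping.keys m \<subseteq> {1..i}}"

lemma mpoly_ring_eq: "mpoly_ring i = ring_on (mpoly_carrier i)"
  by (simp add: mpoly_ring_def ring_on_def mpoly_carrier_def)

lemma carrier_mpoly_ring: "carrier (mpoly_ring i) = mpoly_carrier i"
  by (simp add: mpoly_ring_eq)

lemma mpoly_carrier_single: "Poly_Mapping.keys m \<subseteq> {1..i} \<Longrightarrow> Poly_Mapping.single m a \<in> mpoly_carrier i"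
  by (simp add: mpoly_carrier_def)

lemma subring_set_mpoly: "subring_set (mpoly_carrier i)"
  unfolding subring_set_def
proof (intro conjI ballI)
  show "1 \<in> mpoly_carrier i" by (simp add: mpoly_carrier_def)
  fix g h :: "'a mpoly" assume gh: "g \<in> mpoly_carrier i" "h \<in> mpoly_carrier i"
  show "g - h \<in> mpoly_carrier i"
  proof -
    have "Poly_Mapping.keys (g - h) \<subseteq> Poly_Mapping.keys g \<union> Poly_Mapping.keys h"
      by (auto simp: in_keys_iff lookup_minus)
    thus ?thesis using gh unfolding mpoly_carrier_def by blast
  qed
  show "g * h \<in> mpoly_carrier i"
    unfolding mpoly_carrier_def
  proof (intro CollectI ballI)
    fix m assume "m \<in> Poly_Mapping.keys (g * h)"
    then obtain a b where m: "m = a + b" "a \<in> Poly_Mapping.keys g" "b \<in> Poly_Mapping.keys h"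
      using keys_mult[of g h] by blast
    hence "Poly_Mapping.keys a \<subseteq> {1..i}" "Poly_Mapping.keys b \<subseteq> {1..i}"
      using gh by (simp_all add: mpoly_carrier_def)
    thus "Poly_Mapping.keys m \<subseteq> {1..i}" unfolding m(1) using keys_add[of a b] by blast
  qed
qed

lemma indet_in_mpoly_carrier: "j \<in> {1..i} \<Longrightarrow> indet j \<in> mpoly_carrier i"
  unfolding indet_def by (intro mpoly_carrier_single) auto

lemma mpoly_carrier_mono:
  assumes "i \<le> j"
  shows "mpoly_carrier i \<subseteq> mpoly_carrier j"
proof -
  have "{1..i} \<subseteq> {1..j}" using assms by simp
  hence *: "S \<subseteq> {1..j}" if "S \<subseteq> {1..i}" for S using that by (rule order.trans[rotated])
  show ?thesis
    unfolding mpoly_carrier_def by (intro Collect_mono impI ballI) (rule *, erule (1) bspec)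
qed

lemma indet_power: "(indet i :: 'a::comm_ring_1 mpoly) ^ n = Poly_Mapping.single (Poly_Mapping.single i n) 1"
proof (induction n)
  case 0
  show ?case unfolding power_0 single_zero single_one by (rule refl)
next
  case (Suc n)
  have "Poly_Mapping.single i 1 + Poly_Mapping.single i n = Poly_Mapping.single i (1 + n)"
    by (rule single_add[symmetric])
  hence *: "Poly_Mapping.single i 1 + Poly_Mapping.single i n = Poly_Mapping.single i (Suc n)"
    unfolding plus_1_eq_Suc .
  show ?case unfolding power_Suc Suc.IH unfolding indet_def mult_single * mult_1_left by (rule refl)
qed

text \<open>This is the surjectivity of \<open>F[X_1, ..., X_i][T] \<rightarrow> F[X_1, ..., X_(i+1)]\<close>, \<open>T \<mapsto> X_(i+1)\<close>, which allows a polynomial to be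
  treated as univariate in its last indeterminate.\<close>

lemma mpoly_as_poly_in_last:
  assumes "g \<in> mpoly_carrier (Suc i)"
  shows "\<exists>P\<in>polys_over (mpoly_carrier i). poly P (indet (Suc i)) = g"
proof (induction g rule: poly_mapping_monomial_induct)
  case 1
  show ?case
    using subring_set_zero[OF subring_set_polys_over[OF subring_set_mpoly]] by (intro bexI[of _ 0]) auto
next
  case (2 m)
  define k where "k = Poly_Mapping.lookup m (Suc i)"
  define m' where "m' = m - Poly_Mapping.single (Suc i) k"
  define a where "a = Poly_Mapping.lookup g m"
  have "Poly_Mapping.keys m' \<subseteq> {1..i}"
  proof
    fix j assume "j \<in> Poly_Mapping.keys m'"
    hence nz: "Poly_Mapping.lookup m' j \<noteq> 0" by (rule in_keys_iff[THEN iffD1])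
    have "j \<noteq> Suc i"
      using nz by (intro notI) (simp add: m'_def k_def lookup_minus)
    moreover have "Poly_Mapping.lookup m j \<noteq> 0"
      using nz by (intro notI) (simp add: m'_def lookup_minus)
    hence "j \<in> Poly_Mapping.keys m" by (simp add: in_keys_iff)
    hence "j \<in> {1..Suc i}"
      using assms 2 unfolding mpoly_carrier_def by blast
    ultimately have "j \<in> {1..Suc i}" "j \<noteq> Suc i" by blast+
    thus "j \<in> {1..i}" by simp
  qed
  hence "Polynomial.monom (Poly_Mapping.single m' a) k \<in> polys_over (mpoly_carrier i)"
    by (intro polys_over_monom subring_set_mpoly mpoly_carrier_single)
  moreover have "m = m' + Poly_Mapping.single (Suc i) k"
    by (rule poly_mapping_eqI) (auto simp: m'_def k_def lookup_add lookup_minus lookup_single when_def)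
  hence "poly (Polynomial.monom (Poly_Mapping.single m' a) k) (indet (Suc i)) = Poly_Mapping.single m a"
    by (simp only: poly_monom indet_power mult_single mult_1_right)
  ultimately show ?case unfolding a_def by blast
next
  case (3 g h)
  then obtain P Q where "P \<in> polys_over (mpoly_carrier i)" "poly P (indet (Suc i)) = g"
    "Q \<in> polys_over (mpoly_carrier i)" "poly Q (indet (Suc i)) = h" by blast
  thus ?case
    using subring_set_add[OF subring_set_polys_over[OF subring_set_mpoly]]
    by (intro bexI[of _ "P + Q"]) simp_all
qed

lemma poly_indet_in_mpoly_carrier:
  assumes "P \<in> polys_over (mpoly_carrier n)"
  shows "poly P (indet (Suc n)) \<in> mpoly_carrier (Suc n)"
  using polys_over_mono[OF mpoly_carrier_mono[of n "Suc n"]] assms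
  by (intro subring_set_polyval subring_set_mpoly indet_in_mpoly_carrier) auto

lemma f_seq_Suc: "f_seq p (Suc n) = indet (Suc n) ^ p - indet (Suc n) - as_const p indet n"
  by (simp add: f_seq_def as_const_def)

lemma as_const_in:
  assumes "subring_set S" "\<And>j. j \<in> {1..n} \<Longrightarrow> y j \<in> S"
  shows "as_const p y n \<in> S"
  unfolding as_const_def by (intro subring_set_power subring_set_prod assms)

lemma f_seq_in_mpoly_carrier:
  assumes "j \<in> {1..i}"
  shows "f_seq p j \<in> mpoly_carrier i"
proof -
  from assms obtain n where n: "j = Suc n" by (cases j) auto
  note S = subring_set_mpoly[of i]
  show ?thesis
    unfolding n f_seq_Suc
    by (intro subring_set_diff[OF S] subring_set_power[OF S] as_const_in[OF S] indet_in_mpoly_carrier)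
      (use assms n in auto)
qed

lemma as_const_monomial:
  "as_const p indet n = (Poly_Mapping.single (\<Sum>j = 1..n. Poly_Mapping.single j (p - 1)) 1 :: 'a::comm_ring_1 mpoly)"
proof -
  have "(\<Prod>j = 1..n. (indet j :: 'a mpoly) ^ e) = Poly_Mapping.single (\<Sum>j = 1..n. Poly_Mapping.single j e) 1" for e
  proof (induction n)
    case (Suc n)
    thus ?case by (simp only: prod.atLeast_Suc_atMost_Suc_shift prod.cl_ivl_Suc sum.cl_ivl_Suc indet_power mult_single) simp
  qed simp
  thus ?thesis by (simp add: as_const_def prod_power_distrib)
qed

text \<open>All three monomials of \<open>f_seq p (Suc n)\<close> are explicit, and only the first of them has degree at least \<open>p\<close> in the last
  indeterminate, its coefficient being \<open>1\<close>.\<close>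

lemma monic_in_f_seq:
  assumes p: "p > 1"
  shows "monic_in (Suc n) (f_seq p (Suc n) :: 'a::field mpoly)"
proof -
  let ?i = "Suc n"
  let ?f = "f_seq p ?i :: 'a mpoly"
  define mu where "mu = (\<Sum>j = 1..n. Poly_Mapping.single j (p - 1))"
  define top where "top = Poly_Mapping.single ?i p"
  have mu: "Poly_Mapping.lookup mu ?i = 0"
    by (simp add: mu_def lookup_sum lookup_single when_def)
  have f: "?f = Poly_Mapping.single top 1 - Poly_Mapping.single (Poly_Mapping.single ?i 1) 1 - Poly_Mapping.single mu 1"
    unfolding f_seq_Suc as_const_monomial indet_power mu_def top_def by (simp add: indet_def)
  have top: "Poly_Mapping.lookup top ?i = p" by (simp add: top_def)
  have ne: "top \<noteq> Poly_Mapping.single ?i 1" "top \<noteq> mu"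
    using p top mu by (auto simp: lookup_single dest: arg_cong[of _ _ "\<lambda>m. Poly_Mapping.lookup m ?i"])
  have coeff: "Poly_Mapping.lookup ?f top = 1"
    using ne by (simp add: f lookup_minus lookup_single_not_eq)
  have keys: "Poly_Mapping.keys ?f \<subseteq> {top, Poly_Mapping.single ?i 1, mu}"
    by (auto simp: f in_keys_iff lookup_minus lookup_single when_def split: if_splits)
  have top_key: "top \<in> Poly_Mapping.keys ?f" using coeff by (simp add: in_keys_iff)
  have deg: "deg_in ?i ?f = p"
    unfolding deg_in_def
  proof (rule Max_eqI)
    show "p \<in> insert 0 ((\<lambda>m. Poly_Mapping.lookup m ?i) ` Poly_Mapping.keys ?f)"
      using top_key top by force
    fix y assume "y \<in> insert 0 ((\<lambda>m. Poly_Mapping.lookup m ?i) ` Poly_Mapping.keys ?f)"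
    thus "y \<le> p" using keys p top mu by (auto simp: lookup_single)
  qed simp
  have "{m \<in> Poly_Mapping.keys ?f. Poly_Mapping.lookup m ?i = p} = {top}"
    using keys top_key top mu p by (auto simp: lookup_single)
  thus ?thesis
    by (simp add: monic_in_def deg coeff_in_def coeff) (simp add: top_def)
qed

lemma ideal_tower_ideal:
  assumes "\<And>k. k \<in> {1..j} \<Longrightarrow> f k \<in> mpoly_carrier i"
  shows "ideal (tower_ideal f i j) (ring_on (mpoly_carrier i))"
  unfolding tower_ideal_def mpoly_ring_eq
  by (rule ring.genideal_ideal[OF ring_on_ring[OF subring_set_mpoly]]) (use assms in auto)

lemma gen_in_tower_ideal:
  assumes "\<And>k. k \<in> {1..j} \<Longrightarrow> f k \<in> mpoly_carrier i" "k \<in> {1..j}"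
  shows "f k \<in> tower_ideal f i j"
proof -
  have "f ` {1..j} \<subseteq> tower_ideal f i j"
    unfolding tower_ideal_def mpoly_ring_eq
    by (rule ring.genideal_self[OF ring_on_ring[OF subring_set_mpoly]]) (use assms(1) in auto)
  thus ?thesis using assms(2) by blast
qed

lemma tower_ideal_least:
  assumes "ideal I (ring_on (mpoly_carrier i))" "\<And>k. k \<in> {1..j} \<Longrightarrow> f k \<in> I"
  shows "tower_ideal f i j \<subseteq> I"
  unfolding tower_ideal_def mpoly_ring_eq
  by (rule ring.genideal_minimal[OF ring_on_ring[OF subring_set_mpoly]]) (use assms in auto)

text \<open>The ideals live in different rings when \<open>i < i'\<close>; the larger one is therefore contracted to the smaller ring before
  minimality is applied.\<close>

lemma tower_ideal_mono:
  assumes f: "\<And>i j. j \<in> {1..i} \<Longrightarrow> f j \<in> mpoly_carrier i" and ij: "i \<le> i'" "j \<le> j'" "j \<le> i" "j' \<le> i'"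
  shows "tower_ideal f i j \<subseteq> tower_ideal f i' j'"
proof -
  have f': "\<And>k. k \<in> {1..j'} \<Longrightarrow> f k \<in> mpoly_carrier i'" using f ij by auto
  note J = ideal_tower_ideal[where f=f, OF f']
  note E = ring_on_idealE[OF J]
  have "ideal (tower_ideal f i' j' \<inter> mpoly_carrier i) (ring_on (mpoly_carrier i))"
    using mpoly_carrier_mono[OF ij(1), where 'a='a]
    by (intro ring_on_idealI subring_set_mpoly)
      (auto intro: E(2,3,4) subring_set_zero subring_set_add subring_set_mult subring_set_mpoly)
  hence "tower_ideal f i j \<subseteq> tower_ideal f i' j' \<inter> mpoly_carrier i"
    by (rule tower_ideal_least) (use ij f gen_in_tower_ideal[where f=f, OF f'] in auto)
  thus ?thesis by blast
qed

section \<open>Realising the tower in a field\<close>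

text \<open>The tower is realised inside one big field by the values \<open>x j\<close> of the indeterminates. The last assumption says
  that the base field is mapped into the field with \<open>p\<close> elements.\<close>

locale artin_schreier_tower = artin_schreier_sequence p x + base: comm_ring_hom iota
  for p :: nat and x :: "nat \<Rightarrow> 'b::field" and iota :: "'a::field \<Rightarrow> 'b" +
  assumes iota_fixed: "iota a ^ p = iota a"
begin

definition ev :: "'a mpoly \<Rightarrow> 'b" where
  "ev = eval_mpoly iota x"

text \<open>Evaluation of the indeterminates except \<open>X_(n+1)\<close>, which is turned into the variable of a univariate polynomial ring.\<close>

definition psi :: "nat \<Rightarrow> 'a mpoly \<Rightarrow> 'b poly" where
  "psi n = eval_mpoly (\<lambda>a. [:iota a:]) (\<lambda>j. if j = Suc n then [:0, 1:] else [:x j:])"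

text \<open>The \<open>n\<close>-th field of the tower, as a subring of the big field.\<close>

definition K :: "nat \<Rightarrow> 'b set" where
  "K n = ev ` mpoly_carrier n"

sublocale const: comm_ring_hom "\<lambda>a. [:iota a:]"
  by (rule comm_ring_hom_const_poly) (rule base.comm_ring_hom_axioms)

sublocale ev: comm_ring_hom ev
  unfolding ev_def by (rule base.eval_mpoly_hom)

sublocale psi: comm_ring_hom "psi n" for n
  unfolding psi_def by (rule const.eval_mpoly_hom)

lemma ev_indet: "ev (indet j) = x j"
  by (simp add: ev_def base.eval_mpoly_indet)

lemma psi_indet: "psi n (indet (Suc n)) = [:0, 1:]"
  by (simp add: psi_def const.eval_mpoly_indet)

lemma subring_set_K: "subring_set (K n)"
  unfolding K_def by (rule ev.subring_set_image[OF subring_set_mpoly])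

lemma x_in_K: "j \<in> {1..n} \<Longrightarrow> x j \<in> K n"
  unfolding K_def by (rule image_eqI[of _ _ "indet j"]) (simp_all add: ev_indet indet_in_mpoly_carrier)

lemma K_mono: "i \<le> j \<Longrightarrow> K i \<subseteq> K j"
  unfolding K_def by (intro image_mono mpoly_carrier_mono)

text \<open>The \<open>q n\<close>-power map is a ring homomorphism that fixes the constants and \<open>x 1\<close>, ..., \<open>x n\<close>, which generate \<open>K n\<close>.\<close>

lemma K_fixed:
  assumes "y \<in> K n"
  shows "y ^ q n = y"
proof -
  obtain g where g: "g \<in> mpoly_carrier n" "y = ev g" using assms by (auto simp: K_def)
  have iota: "iota a ^ p ^ k = iota a" for a k
    using iota_fixed by (induction k) (simp_all add: power_mult)
  have "ev g ^ q n = ev g"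
  proof (induction g rule: poly_mapping_monomial_induct)
    case 1
    show ?case using p_gt_1 by (simp add: ev.hom_zero power_0_left)
  next
    case (2 m)
    have "Poly_Mapping.keys m \<subseteq> {1..n}" using 2 g(1) by (simp add: mpoly_carrier_def)
    hence "x j ^ q n = x j" if "j \<in> Poly_Mapping.keys m" for j
      using that trace_sign_and_x_fixed[of n] by blast
    hence "(x j ^ e) ^ q n = x j ^ e" if "j \<in> Poly_Mapping.keys m" for j e
      using that by (metis mult.commute power_mult)
    thus ?case
      by (simp add: ev_def base.eval_mpoly_single power_mult_distrib iota prod_power_distrib)
  next
    case (3 g h)
    thus ?case by (simp add: ev.hom_add frob_add)
  qed
  thus ?thesis using g by simp
qed

text \<open>By \<open>K_fixed\<close>, a nonzero \<open>y\<close> satisfies \<open>y ^ (q n - 1) = 1\<close>, so its inverse is one of its powers.\<close>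

lemma K_inverse:
  assumes "y \<in> K n"
  shows "inverse y \<in> K n"
proof (cases "y = 0")
  case False
  have "q n > 1" using p_gt_1 by (metis less_trans one_less_power zero_less_one zero_less_power)
  then obtain d where d: "q n = Suc (Suc d)" by (metis Suc_lessE One_nat_def less_imp_Suc_add plus_1_eq_Suc)
  have "y * (y * y ^ d) = y * 1" using K_fixed[OF assms] d by simp
  hence "inverse y = y ^ d" using False by (simp add: inverse_unique)
  thus ?thesis using subring_set_power[OF subring_set_K assms] by simp
qed (use assms in simp)

lemma field_K: "field (ring_on (K n))"
  by (rule ring_on_field[OF subring_set_K K_inverse])

lemma psi_const:
  assumes g: "g \<in> mpoly_carrier n"
  shows "psi n g = [:ev g:]"
proof (induction g rule: poly_mapping_monomial_induct)
  case 1
  show ?case by (simp add: psi.hom_zero ev.hom_zero)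
next
  case (2 m)
  have "Poly_Mapping.keys m \<subseteq> {1..n}" using 2 g by (simp add: mpoly_carrier_def)
  hence "(\<Prod>j\<in>Poly_Mapping.keys m. (if j = Suc n then [:0, 1:] else [:x j:]) ^ Poly_Mapping.lookup m j)
      = (\<Prod>j\<in>Poly_Mapping.keys m. [:x j ^ Poly_Mapping.lookup m j:])"
    by (intro prod.cong) (auto simp: poly_const_pow)
  also have "\<dots> = [:\<Prod>j\<in>Poly_Mapping.keys m. x j ^ Poly_Mapping.lookup m j:]"
  proof -
    interpret id: comm_ring_hom "\<lambda>a. [:a:] :: 'b poly"
      using comm_ring_hom_const_poly[of "\<lambda>a. a"] by (simp add: comm_ring_hom_def)
    show ?thesis by (simp add: id.hom_prod)
  qed
  finally show ?case
    by (simp add: psi_def ev_def base.eval_mpoly_single const.eval_mpoly_single)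
next
  case (3 g h)
  thus ?case by (simp add: psi.hom_add ev.hom_add)
qed

lemma psi_poly:
  assumes "P \<in> polys_over (mpoly_carrier n)"
  shows "psi n (poly P (indet (Suc n))) = map_poly ev P"
proof -
  have "map_poly (psi n) P = map_poly (\<lambda>g. [:ev g:]) P"
    using assms psi_const by (intro poly_eqI)
      (simp add: coeff_map_poly polys_over_def psi.hom_zero ev.hom_zero)
  also have "\<dots> = map_poly (\<lambda>a. [:a:]) (map_poly ev P)"
    by (intro poly_eqI) (simp add: coeff_map_poly ev.hom_zero)
  finally show ?thesis
    by (simp add: psi.hom_poly psi_indet poly_map_const_X)
qed

lemma ev_poly: "ev (poly P (indet (Suc n))) = poly (map_poly ev P) (x (Suc n))"
  by (simp add: ev.hom_poly ev_indet)

lemma poly_psi: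
  assumes "g \<in> mpoly_carrier (Suc n)"
  shows "poly (psi n g) (x (Suc n)) = ev g"
proof -
  obtain P where "P \<in> polys_over (mpoly_carrier n)" "g = poly P (indet (Suc n))"
    using mpoly_as_poly_in_last[OF assms] by blast
  thus ?thesis by (simp add: psi_poly ev_poly)
qed

lemma map_poly_ev_in: "P \<in> polys_over (mpoly_carrier n) \<Longrightarrow> map_poly ev P \<in> polys_over (K n)"
  by (simp add: polys_over_def coeff_map_poly ev.hom_zero K_def)

lemma psi_image: "psi n ` mpoly_carrier (Suc n) = polys_over (K n)"
proof (intro equalityI subsetI)
  fix Q assume "Q \<in> psi n ` mpoly_carrier (Suc n)"
  then obtain g where "g \<in> mpoly_carrier (Suc n)" "Q = psi n g" by blast
  moreover from this obtain P where "P \<in> polys_over (mpoly_carrier n)" "g = poly P (indet (Suc n))"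
    using mpoly_as_poly_in_last by blast
  ultimately show "Q \<in> polys_over (K n)" by (simp add: psi_poly map_poly_ev_in)
next
  fix Q assume Q: "Q \<in> polys_over (K n)"
  \<comment> \<open>The section of \<open>ev\<close> has to preserve \<open>0\<close> for \<open>map_poly\<close> to act coefficientwise.\<close>
  define s where "s y = (if y = 0 then 0 else inv_into (mpoly_carrier n) ev y)" for y
  have s: "s y \<in> mpoly_carrier n" "ev (s y) = y" if "y \<in> K n" for y
    using that unfolding K_def s_def
    by (auto intro: inv_into_into f_inv_into_f subring_set_zero[OF subring_set_mpoly] simp: ev.hom_zero)
  have s0: "s 0 = 0" by (simp add: s_def)
  define P where "P = map_poly s Q"
  have P: "P \<in> polys_over (mpoly_carrier n)"
    using Q s(1) by (simp add: P_def polys_over_def coeff_map_poly s0)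
  have "map_poly ev P = Q"
    using Q s(2) by (intro poly_eqI) (simp add: P_def polys_over_def coeff_map_poly s0 ev.hom_zero)
  hence "psi n (poly P (indet (Suc n))) = Q" by (simp add: psi_poly[OF P])
  moreover have "poly P (indet (Suc n)) \<in> mpoly_carrier (Suc n)"
    by (rule poly_indet_in_mpoly_carrier[OF P])
  ultimately show "Q \<in> psi n ` mpoly_carrier (Suc n)" by blast
qed

lemma as_const_in_mpoly_carrier: "as_const p indet n \<in> mpoly_carrier n"
  by (intro as_const_in subring_set_mpoly indet_in_mpoly_carrier)

lemma ev_as_const: "ev (as_const p indet n) = as_const p x n"
  by (simp add: as_const_def ev.hom_power ev.hom_prod ev_indet)

lemma f_seq_as_poly: "f_seq p (Suc n) = poly (as_poly p (as_const p indet n)) (indet (Suc n))"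
  by (simp add: f_seq_Suc poly_as_poly)

lemma ev_f_seq: "ev (f_seq p (Suc n)) = 0"
  by (simp add: f_seq_Suc ev.hom_diff ev.hom_power ev_indet ev_as_const x_Suc)

lemma psi_f_seq: "psi n (f_seq p (Suc n)) = as_poly p (as_const p x n)"
  by (simp add: f_seq_Suc psi.hom_diff psi.hom_power psi_indet psi_const[OF as_const_in_mpoly_carrier] ev_as_const
      as_poly_def monom_altdef)

text \<open>Thus \<open>p\<close> is a lower bound for the degree of \<open>x (Suc n)\<close> over \<open>K n\<close>. The kernels, the irreducibility and the degree of the
  extension are all derived from this bound.\<close>

lemma degree_ge_if_root_K:
  assumes "Q \<in> polys_over (K n)" "Q \<noteq> 0" "poly Q (x (Suc n)) = 0"
  shows "Polynomial.degree Q \<ge> p"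
  using assms by (intro degree_ge_if_root[of Q n]) (auto simp: polys_over_def K_fixed)

text \<open>Dividing before evaluating, in the ring of multivariate polynomials, keeps track of membership in the ideal.\<close>

lemma division_by_f_seq:
  fixes g :: "'a mpoly"
  assumes "g \<in> mpoly_carrier (Suc n)"
  shows "\<exists>h\<in>mpoly_carrier (Suc n). \<exists>R\<in>polys_over (mpoly_carrier n).
    g = h * f_seq p (Suc n) + poly R (indet (Suc n)) \<and> Polynomial.degree R < p"
proof -
  obtain P where P: "P \<in> polys_over (mpoly_carrier n)" "g = poly P (indet (Suc n))"
    using mpoly_as_poly_in_last[OF assms] by blast
  have "\<exists>Q\<in>polys_over (mpoly_carrier n). \<exists>R\<in>polys_over (mpoly_carrier n).
    P = as_poly p (as_const p indet n) * Q + R \<and>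
    Polynomial.degree R < Polynomial.degree (as_poly p (as_const p (indet :: nat \<Rightarrow> 'a mpoly) n))"
    by (intro monic_division_polys_over subring_set_mpoly as_poly_in_polys_over as_const_in_mpoly_carrier P(1))
      (use p_gt_1 in \<open>simp_all add: degree_as_poly[OF p_gt_1]\<close>)
  then obtain Q R where QR: "Q \<in> polys_over (mpoly_carrier n)" "R \<in> polys_over (mpoly_carrier n)"
    "P = as_poly p (as_const p indet n) * Q + R" "Polynomial.degree R < p"
    by (auto simp: degree_as_poly[OF p_gt_1])
  have "poly Q (indet (Suc n)) \<in> mpoly_carrier (Suc n)"
    by (rule poly_indet_in_mpoly_carrier[OF QR(1)])
  moreover have "g = poly Q (indet (Suc n)) * f_seq p (Suc n) + poly R (indet (Suc n))"
    by (simp add: P(2) QR(3) f_seq_as_poly mult.commute)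
  ultimately show ?thesis using QR by blast
qed

lemma degree_map_ev_less:
  assumes "Polynomial.degree R < p"
  shows "Polynomial.degree (map_poly ev R) < p"
  using assms by (intro le_less_trans[OF degree_le assms]) (simp add: coeff_map_poly ev.hom_zero coeff_eq_0)

lemma K_Suc_eq: "K (Suc n) = {poly Q (x (Suc n)) | Q. Q \<in> polys_over (K n) \<and> Polynomial.degree Q < p}"
proof (intro equalityI subsetI)
  fix y assume "y \<in> K (Suc n)"
  then obtain g where g: "g \<in> mpoly_carrier (Suc n)" "y = ev g" by (auto simp: K_def)
  obtain h R where R: "R \<in> polys_over (mpoly_carrier n)" "Polynomial.degree R < p"
      and "g = h * f_seq p (Suc n) + poly R (indet (Suc n))"
    using division_by_f_seq[OF g(1)] by blast
  hence "y = poly (map_poly ev R) (x (Suc n))"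
    by (simp add: g(2) ev.hom_add ev.hom_mult ev_f_seq ev_poly)
  thus "y \<in> {poly Q (x (Suc n)) | Q. Q \<in> polys_over (K n) \<and> Polynomial.degree Q < p}"
    using R map_poly_ev_in degree_map_ev_less by blast
next
  fix y assume "y \<in> {poly Q (x (Suc n)) | Q. Q \<in> polys_over (K n) \<and> Polynomial.degree Q < p}"
  thus "y \<in> K (Suc n)"
    using polys_over_mono[OF K_mono[of n "Suc n"]]
    by (auto intro!: subring_set_polyval[OF subring_set_K] x_in_K)
qed

abbreviation J :: "nat \<Rightarrow> nat \<Rightarrow> 'a mpoly set" where
  "J \<equiv> tower_ideal (f_seq p)"

lemma ideal_J: "j \<le> i \<Longrightarrow> ideal (J i j) (ring_on (mpoly_carrier i))"
  by (rule ideal_tower_ideal) (auto intro: f_seq_in_mpoly_carrier)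

lemma f_seq_in_J: "k \<in> {1..j} \<Longrightarrow> j \<le> i \<Longrightarrow> f_seq p k \<in> J i j"
  by (rule gen_in_tower_ideal) (auto intro: f_seq_in_mpoly_carrier)

lemma J_mono: "i \<le> i' \<Longrightarrow> j \<le> j' \<Longrightarrow> j \<le> i \<Longrightarrow> j' \<le> i' \<Longrightarrow> J i j \<subseteq> J i' j'"
  by (rule tower_ideal_mono) (auto intro: f_seq_in_mpoly_carrier)

lemma J_subset_kernel_ev: "J n n \<subseteq> {g \<in> mpoly_carrier n. ev g = 0}"
proof (rule tower_ideal_least)
  show "ideal {g \<in> mpoly_carrier n. ev g = 0} (ring_on (mpoly_carrier n))"
    by (intro ring_on_idealI subring_set_mpoly)
      (auto simp: ev.hom_zero ev.hom_add ev.hom_mult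
        intro: subring_set_zero subring_set_add subring_set_mult subring_set_mpoly)
  fix k assume k: "k \<in> {1..n}"
  then obtain m where "k = Suc m" by (cases k) auto
  thus "f_seq p k \<in> {g \<in> mpoly_carrier n. ev g = 0}"
    using k by (simp add: ev_f_seq f_seq_in_mpoly_carrier)
qed

lemma J_subset_kernel_psi: "J (Suc n) n \<subseteq> {g \<in> mpoly_carrier (Suc n). psi n g = 0}"
proof (rule tower_ideal_least)
  show "ideal {g \<in> mpoly_carrier (Suc n). psi n g = 0} (ring_on (mpoly_carrier (Suc n)))"
    by (intro ring_on_idealI subring_set_mpoly)
      (auto simp: psi.hom_zero psi.hom_add psi.hom_mult
        intro: subring_set_zero subring_set_add subring_set_mult subring_set_mpoly)
  fix k assume k: "k \<in> {1..n}"
  then obtain m where m: "k = Suc m" by (cases k) auto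
  have "psi n (f_seq p k) = 0"
    using k by (subst psi_const) (auto simp: m ev_f_seq intro: f_seq_in_mpoly_carrier)
  thus "f_seq p k \<in> {g \<in> mpoly_carrier (Suc n). psi n g = 0}"
    using k by (simp add: f_seq_in_mpoly_carrier)
qed

text \<open>If the coefficients of \<open>g\<close> with respect to \<open>X_(n+1)\<close> vanish under evaluation, then each of them lies in the ideal of
  the previous stage, and so does their combination \<open>g\<close>.\<close>

lemma kernel_psi_subset:
  assumes IH: "{g \<in> mpoly_carrier n. ev g = 0} \<subseteq> J n n"
    and g: "g \<in> mpoly_carrier (Suc n)" "psi n g = 0"
  shows "g \<in> J (Suc n) n"
proof -
  obtain P where P: "P \<in> polys_over (mpoly_carrier n)" "g = poly P (indet (Suc n))"
    using mpoly_as_poly_in_last[OF g(1)] by blast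
  have "map_poly ev P = 0" using g(2) by (simp add: P psi_poly)
  hence "ev (Polynomial.coeff P k) = 0" for k
    by (metis coeff_0 coeff_map_poly ev.hom_zero)
  hence "Polynomial.coeff P k \<in> J (Suc n) n" for k
    using P(1) IH J_mono[of n "Suc n" n n] by (auto simp: polys_over_def)
  moreover note I = ideal_J[of n "Suc n"]
  ultimately show ?thesis
    unfolding P(2) poly_altdef mult.commute[of "Polynomial.coeff P _"]
    by (intro ring_on_ideal_sum[OF I] ring_on_idealE(4)[OF I] subring_set_power[OF subring_set_mpoly]
        indet_in_mpoly_carrier) auto
qed

text \<open>In the induction step, \<open>g\<close> is divided by \<open>f_seq p (Suc n)\<close>. The remainder has degree less than \<open>p\<close> in the last indeterminate
  and evaluates to \<open>0\<close> at \<open>x (Suc n)\<close>, so all its coefficients evaluate to \<open>0\<close> by the lower bound for the degree; hence it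
  belongs to the ideal generated by the earlier polynomials.\<close>

lemma kernel_ev_subset: "{g \<in> mpoly_carrier n. ev g = 0} \<subseteq> J n n"
proof (induction n)
  case 0
  have "g = 0" if "g \<in> mpoly_carrier 0" "ev g = 0" for g
  proof -
    have keys: "Poly_Mapping.keys g \<subseteq> {0}"
      using that(1) by (auto simp: mpoly_carrier_def)
    hence g: "g = Poly_Mapping.single 0 (Poly_Mapping.lookup g 0)"
      by (intro poly_mapping_eqI) (auto simp: lookup_single when_def in_keys_iff)
    have "iota (Poly_Mapping.lookup g 0) = 0"
      using that(2) by (subst (asm) g) (simp add: ev_def base.eval_mpoly_single)
    hence "Poly_Mapping.lookup g 0 = 0"
      by (metis base.hom_mult base.hom_one mult_zero_left right_inverse zero_neq_one)
    thus ?thesis by (subst g) simp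
  qed
  thus ?case using ring_on_idealE(2)[OF ideal_J[of 0 0]] by auto
next
  case (Suc n)
  show ?case
  proof safe
    fix g assume g: "g \<in> mpoly_carrier (Suc n)" "ev g = 0"
    obtain h R where R: "R \<in> polys_over (mpoly_carrier n)" "Polynomial.degree R < p"
      and h: "h \<in> mpoly_carrier (Suc n)"
      and gh: "g = h * f_seq p (Suc n) + poly R (indet (Suc n))"
      using division_by_f_seq[OF g(1)] by blast
    have "poly (map_poly ev R) (x (Suc n)) = 0"
      using g(2) by (simp add: gh ev.hom_add ev.hom_mult ev_f_seq ev_poly)
    hence "map_poly ev R = 0"
      using degree_ge_if_root_K[OF map_poly_ev_in[OF R(1)]] degree_map_ev_less[OF R(2)] by force
    moreover have "poly R (indet (Suc n)) \<in> mpoly_carrier (Suc n)"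
      by (rule poly_indet_in_mpoly_carrier[OF R(1)])
    ultimately have "poly R (indet (Suc n)) \<in> J (Suc n) n"
      using kernel_psi_subset[OF Suc.IH] by (simp add: psi_poly[OF R(1)])
    hence "poly R (indet (Suc n)) \<in> J (Suc n) (Suc n)"
      using J_mono[of "Suc n" "Suc n" n "Suc n"] by auto
    moreover note I = ring_on_idealE[OF ideal_J[of "Suc n" "Suc n"]]
    ultimately show "g \<in> J (Suc n) (Suc n)"
      unfolding gh by (intro I(3) I(4) h f_seq_in_J) auto
  qed
qed

lemma kernel_ev: "a_kernel (mpoly_ring n) (ring_on (K n)) ev = J n n"
  using kernel_ev_subset J_subset_kernel_ev
  unfolding a_kernel_def' mpoly_ring_eq by auto

lemma kernel_psi: "a_kernel (mpoly_ring (Suc n)) (ring_on (polys_over (K n))) (psi n) = J (Suc n) n"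
  using kernel_psi_subset[OF kernel_ev_subset] J_subset_kernel_psi
  unfolding a_kernel_def' mpoly_ring_eq by auto

text \<open>In a factorisation over \<open>K n\<close>, the factor that vanishes at \<open>x (Suc n)\<close> has the full degree \<open>p\<close>, which leaves a nonzero
  constant for the other one.\<close>

lemma irreducible_psi_f_seq:
  "ring_irreducible\<^bsub>ring_on (polys_over (K n))\<^esub> (psi n (f_seq p (Suc n)))"
proof (rule domain.ring_irreducibleI)
  let ?F = "psi n (f_seq p (Suc n))"
  have S: "subring_set (polys_over (K n))" by (rule subring_set_polys_over[OF subring_set_K])
  show "domain (ring_on (polys_over (K n)))" by (rule ring_on_domain[OF S])
  have degF: "Polynomial.degree ?F = p" by (simp add: psi_f_seq degree_as_poly[OF p_gt_1])
  have F0: "?F \<noteq> 0" using degF p_gt_1 by auto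
  have "?F \<in> polys_over (K n)" using psi_image f_seq_in_mpoly_carrier by fastforce
  with F0 show "?F \<in> carrier (ring_on (polys_over (K n))) - {\<zero>\<^bsub>ring_on (polys_over (K n))\<^esub>}" by simp
  show "?F \<notin> Units (ring_on (polys_over (K n)))"
  proof
    assume "?F \<in> Units (ring_on (polys_over (K n)))"
    then obtain b where b: "?F * b = 1" unfolding ring_on_Units by blast
    hence "b \<noteq> 0" by auto
    hence "Polynomial.degree (?F * b) \<ge> p" using F0 degF by (simp add: degree_mult_eq)
    thus False using b p_gt_1 by simp
  qed
  have unit_if: "b \<in> Units (ring_on (polys_over (K n)))"
    if ab: "a \<in> polys_over (K n)" "b \<in> polys_over (K n)" "?F = a * b" and root: "poly a (x (Suc n)) = 0" for a b
  proof -
    have nz: "a \<noteq> 0" "b \<noteq> 0" using ab(3) F0 by auto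
    have "p = Polynomial.degree a + Polynomial.degree b"
      using degF ab(3) nz by (simp add: degree_mult_eq)
    moreover have "Polynomial.degree a \<ge> p" by (rule degree_ge_if_root_K[OF ab(1) nz(1) root])
    ultimately have "Polynomial.degree b = 0" by simp
    then obtain c where c: "b = [:c:]" by (rule degree_eq_zeroE)
    have "c \<in> K n" using ab(2) by (simp add: c polys_over_const[OF subring_set_K])
    hence "[:inverse c:] \<in> polys_over (K n)" by (simp add: polys_over_const[OF subring_set_K] K_inverse)
    moreover have "b * [:inverse c:] = 1" using nz(2) by (simp add: c)
    ultimately show ?thesis using ab(2) unfolding ring_on_Units by blast
  qed
  fix a b assume ab: "a \<in> carrier (ring_on (polys_over (K n)))" "b \<in> carrier (ring_on (polys_over (K n)))"
    "?F = a \<otimes>\<^bsub>ring_on (polys_over (K n))\<^esub> b"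
  have "poly ?F (x (Suc n)) = 0"
    by (subst poly_psi) (simp_all add: f_seq_in_mpoly_carrier ev_f_seq)
  hence "poly (a * b) (x (Suc n)) = 0" using ab(3) by simp
  hence "poly a (x (Suc n)) = 0 \<or> poly b (x (Suc n)) = 0" by simp
  thus "a \<in> Units (ring_on (polys_over (K n))) \<or> b \<in> Units (ring_on (polys_over (K n)))"
    using unit_if[of a b] unit_if[of b a] ab by (auto simp: mult.commute)
qed

section \<open>The quotient fields and their degrees\<close>

text \<open>The powers of \<open>x (Suc n)\<close> with exponents below \<open>p\<close> are a basis: they are independent by the lower bound for the
  degree, and they span by division by \<open>f_seq p (Suc n)\<close>.\<close>

lemma dimension_K: "ring.dimension (ring_on (K (Suc n))) p (K n) (K (Suc n))"
proof -
  interpret B: field "ring_on (K (Suc n))" by (rule field_K)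
  note S = subring_set_K
  have sub: "K n \<subseteq> K (Suc n)" by (rule K_mono) simp
  have sf: "subfield (K n) (ring_on (K (Suc n)))"
    by (intro subfield_ring_on S K_inverse sub)
  define Us where "Us = map (\<lambda>k. x (Suc n) ^ k) [0..<p]"
  have Us: "set Us \<subseteq> carrier (ring_on (K (Suc n)))"
    by (auto simp: Us_def intro!: subring_set_power[OF S] x_in_K)
  have combine: "B.combine Ks Us = poly (Poly (take p Ks)) (x (Suc n))" for Ks
    using combine_powers[OF S, where Ks = Ks and y = "x (Suc n)" and m = 0 and n = p] by (simp add: Us_def)
  have Poly_in: "Poly Ks \<in> polys_over (K n)" if "set Ks \<subseteq> K n" for Ks
    using that subring_set_zero[OF S] by (auto simp: polys_over_def coeff_Poly_eq nth_default_def)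
  have deg: "Polynomial.degree (Poly (take p Ks)) < p" for Ks :: "'b list"
    by (rule le_less_trans[OF degree_le[of "p - 1"]])
      (use p_gt_1 in \<open>auto simp: coeff_Poly_eq nth_default_def\<close>)
  have ind: "B.independent (K n) Us"
  proof (rule B.trivial_combine_imp_independent[OF sf Us])
    fix Ks assume Ks: "set Ks \<subseteq> K n" "B.combine Ks Us = \<zero>\<^bsub>ring_on (K (Suc n))\<^esub>"
    have "set (take p Ks) \<subseteq> K n" using Ks(1) set_take_subset by fast
    hence "Poly (take p Ks) = 0"
      using degree_ge_if_root_K[OF Poly_in] Ks(2) deg[of Ks] by (force simp: combine)
    thus "set (take (length Us) Ks) \<subseteq> {\<zero>\<^bsub>ring_on (K (Suc n))\<^esub>}"
      by (auto simp: Us_def Poly_eq_0 dest!: arg_cong[of _ _ set] split: if_splits)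
  qed
  have span: "B.Span (K n) Us = {poly (Poly (take p Ks)) (x (Suc n)) |Ks. set Ks \<subseteq> K n}"
    using B.Span_eq_combine_set[OF sf Us] by (simp only: combine)
  have "{poly (Poly (take p Ks)) (x (Suc n)) |Ks. set Ks \<subseteq> K n} =
    {poly Q (x (Suc n)) |Q. Q \<in> polys_over (K n) \<and> Polynomial.degree Q < p}"
  proof (intro equalityI subsetI)
    fix y assume "y \<in> {poly (Poly (take p Ks)) (x (Suc n)) |Ks. set Ks \<subseteq> K n}"
    then obtain Ks where "y = poly (Poly (take p Ks)) (x (Suc n))" "set Ks \<subseteq> K n" by blast
    moreover from this have "set (take p Ks) \<subseteq> K n" using set_take_subset by fast
    ultimately show "y \<in> {poly Q (x (Suc n)) |Q. Q \<in> polys_over (K n) \<and> Polynomial.degree Q < p}"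
      using Poly_in deg by blast
  next
    fix y assume "y \<in> {poly Q (x (Suc n)) |Q. Q \<in> polys_over (K n) \<and> Polynomial.degree Q < p}"
    then obtain Q where Q: "y = poly Q (x (Suc n))" "Q \<in> polys_over (K n)" "Polynomial.degree Q < p" by blast
    have "length (coeffs Q) \<le> p" using Q(3) by (cases "Q = 0") (auto simp: length_coeffs_degree)
    hence "y = poly (Poly (take p (coeffs Q))) (x (Suc n))" using Q(1) by simp
    moreover have "set (coeffs Q) \<subseteq> K n"
      using Q(2) by (auto simp: polys_over_def coeffs_def)
    ultimately show "y \<in> {poly (Poly (take p Ks)) (x (Suc n)) |Ks. set Ks \<subseteq> K n}" by blast
  qed
  hence "B.Span (K n) Us = K (Suc n)" by (intro trans[OF span] trans[OF _ K_Suc_eq[symmetric]])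
  with ind have "B.dimension (length Us) (K n) (K (Suc n))"
    by (rule B.dimensionI[OF sf])
  thus ?thesis by (simp add: Us_def)
qed

lemma ev_ring_hom_ring: "ring_hom_ring (mpoly_ring n) (ring_on (K n)) ev"
  unfolding mpoly_ring_eq K_def by (rule ev.ring_on_image_hom[OF subring_set_mpoly])

lemma psi_ring_hom_ring: "ring_hom_ring (mpoly_ring (Suc n)) (ring_on (polys_over (K n))) (psi n)"
  unfolding mpoly_ring_eq psi_image[symmetric] by (rule psi.ring_on_image_hom[OF subring_set_mpoly])

lemma ring_Quot_J: "j \<le> i \<Longrightarrow> ring (mpoly_ring i Quot J i j)"
  unfolding mpoly_ring_eq by (intro ideal.quotient_is_ring ideal_J)

lemma f_seq_irreducible_mod_J:
  "ring_irreducible\<^bsub>mpoly_ring (Suc n) Quot J (Suc n) n\<^esub>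
     (J (Suc n) n +>\<^bsub>mpoly_ring (Suc n)\<^esub> f_seq p (Suc n))"
proof (rule ring_iso_irreducible)
  interpret psi': ring_hom_ring "mpoly_ring (Suc n)" "ring_on (polys_over (K n))" "psi n"
    by (rule psi_ring_hom_ring)
  note k = kernel_psi[of n]
  have f: "f_seq p (Suc n) \<in> carrier (mpoly_ring (Suc n) :: 'a mpoly ring)"
    by (simp add: mpoly_ring_eq f_seq_in_mpoly_carrier)
  show "(\<lambda>C. the_elem (psi n ` C)) \<in> ring_iso (mpoly_ring (Suc n) Quot J (Suc n) n) (ring_on (polys_over (K n)))"
    using psi'.FactRing_iso_set unfolding k by (simp add: mpoly_ring_eq psi_image)
  show "ring (mpoly_ring (Suc n) Quot J (Suc n) n)" by (rule ring_Quot_J) simp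
  show "ring (ring_on (polys_over (K n)))" by (rule psi'.S.ring_axioms)
  show "J (Suc n) n +>\<^bsub>mpoly_ring (Suc n)\<^esub> f_seq p (Suc n) \<in> carrier (mpoly_ring (Suc n) Quot J (Suc n) n)"
    using f by (auto simp: FactRing_def A_RCOSETS_def')
  show "ring_irreducible\<^bsub>ring_on (polys_over (K n))\<^esub>
      (the_elem (psi n ` (J (Suc n) n +>\<^bsub>mpoly_ring (Suc n)\<^esub> f_seq p (Suc n))))"
    using psi'.the_elem_simp[OF f] irreducible_psi_f_seq unfolding k by simp
qed

lemma tower_field_iso:
  "(\<lambda>C. the_elem (ev ` C)) \<in> ring_iso (tower_field (f_seq p) n) (ring_on (K n))"
proof -
  interpret ev': ring_hom_ring "mpoly_ring n" "ring_on (K n)" ev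
    by (rule ev_ring_hom_ring)
  show ?thesis
    using ev'.FactRing_iso_set unfolding kernel_ev tower_field_def
    by (simp add: mpoly_ring_eq K_def)
qed

text \<open>Adding the larger ideal to a coset of the smaller one absorbs the latter.\<close>

lemma tower_emb_coset:
  assumes "g \<in> mpoly_carrier n"
  shows "tower_emb (f_seq p) (Suc n) (J n n +>\<^bsub>mpoly_ring n\<^esub> g) = J (Suc n) (Suc n) +>\<^bsub>mpoly_ring (Suc n)\<^esub> g"
proof -
  have sub: "J n n \<subseteq> J (Suc n) (Suc n)" by (rule J_mono) auto
  note I = ring_on_idealE[OF ideal_J[of "Suc n" "Suc n"]]
  have z: "0 \<in> J n n" by (rule ring_on_idealE(2)[OF ideal_J]) simp
  have "(\<Union>j\<in>J (Suc n) (Suc n). \<Union>i\<in>J n n. {j + (i + g)}) = (\<Union>j\<in>J (Suc n) (Suc n). {j + g})"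
  proof (intro equalityI subsetI)
    fix u assume "u \<in> (\<Union>j\<in>J (Suc n) (Suc n). \<Union>i\<in>J n n. {j + (i + g)})"
    then obtain j i where ji: "j \<in> J (Suc n) (Suc n)" "i \<in> J n n" "u = j + (i + g)" by blast
    hence "j + i \<in> J (Suc n) (Suc n)" "u = (j + i) + g" using I(3) sub by (auto simp: add.assoc)
    thus "u \<in> (\<Union>j\<in>J (Suc n) (Suc n). {j + g})" by blast
  next
    fix u assume "u \<in> (\<Union>j\<in>J (Suc n) (Suc n). {j + g})"
    then obtain j where "j \<in> J (Suc n) (Suc n)" "u = j + (0 + g)" by auto
    thus "u \<in> (\<Union>j\<in>J (Suc n) (Suc n). \<Union>i\<in>J n n. {j + (i + g)})" using z by blast
  qed
  thus ?thesis
    by (simp add: tower_emb_def set_add_def' a_r_coset_def' mpoly_ring_eq)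
qed

lemma extension_degree_tower:
  "extension_degree (tower_field (f_seq p) n) (tower_field (f_seq p) (Suc n))
     (tower_emb (f_seq p :: nat \<Rightarrow> 'a mpoly) (Suc n)) p"
proof (rule extension_degree_transfer[OF tower_field_iso _ field_K tower_field_iso _ field_K])
  show "ring (tower_field (f_seq p :: nat \<Rightarrow> 'a mpoly) m)" for m
    unfolding tower_field_def by (rule ring_Quot_J) simp
  show "ring (tower_field (f_seq p :: nat \<Rightarrow> 'a mpoly) m)" for m
    unfolding tower_field_def by (rule ring_Quot_J) simp
  show "subfield (carrier (ring_on (K n))) (ring_on (K (Suc n)))"
    by (simp add: subfield_ring_on subring_set_K K_inverse K_mono)
  show "ring.dimension (ring_on (K (Suc n))) p (carrier (ring_on (K n))) (carrier (ring_on (K (Suc n))))"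
    by (simp add: dimension_K)
  fix C assume "C \<in> carrier (tower_field (f_seq p :: nat \<Rightarrow> 'a mpoly) n)"
  then obtain g where g: "g \<in> mpoly_carrier n" "C = J n n +>\<^bsub>mpoly_ring n\<^esub> g"
    by (auto simp: tower_field_def FactRing_def A_RCOSETS_def' carrier_mpoly_ring)
  have g': "g \<in> mpoly_carrier (Suc n)" using mpoly_carrier_mono[of n "Suc n"] g(1) by auto
  have val: "the_elem (ev ` (J m m +>\<^bsub>mpoly_ring m\<^esub> g)) = ev g" if "g \<in> mpoly_carrier m" for m
    using ring_hom_ring.the_elem_simp[OF ev_ring_hom_ring, of g m] that
    unfolding kernel_ev by (simp add: carrier_mpoly_ring)
  show "tower_emb (f_seq p) (Suc n) C \<in> carrier (tower_field (f_seq p) (Suc n)) \<and>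
      the_elem (ev ` tower_emb (f_seq p) (Suc n) C) = the_elem (ev ` C)"
    using g' val[OF g(1)] val[OF g']
    by (auto simp: g(2) tower_emb_coset[OF g(1)] tower_field_def FactRing_def A_RCOSETS_def' carrier_mpoly_ring)
qed simp_all

end

section \<open>The tower over the prime field\<close>

theorem proposition5p1:
  fixes p l :: nat
  assumes "Factorial_Ring.prime p" and "card (UNIV :: 'a::field set) = p" and "l \<ge> 1"
  shows "defines_tower l (f_seq p :: nat \<Rightarrow> 'a mpoly) \<and>
         (\<forall>i \<in> {1..l}.
            extension_degree
              (tower_field (f_seq p :: nat \<Rightarrow> 'a mpoly) (i - 1))
              (tower_field (f_seq p) i) (tower_emb (f_seq p) i) p)"
proof -
  have p1: "p > 1" by (rule prime_gt_1_nat[OF assms(1)])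
  note F = finite_prime_field[OF assms(1,2)]
  obtain x :: "nat \<Rightarrow> 'a alg_closure" where x: "\<And>n. x (Suc n) ^ p = x (Suc n) + as_const p x n"
    using artin_schreier_sequence_exists[OF p1] by blast
  interpret artin_schreier_tower p x to_ac
    by standard (use assms(1) F x in \<open>simp_all flip: to_ac_power\<close>)
  have step: "f_seq p i \<in> carrier (mpoly_ring i :: 'a mpoly ring) \<and> monic_in i (f_seq p i :: 'a mpoly) \<and>
      ring_irreducible\<^bsub>mpoly_ring i Quot J i (i - 1)\<^esub> (J i (i - 1) +>\<^bsub>mpoly_ring i\<^esub> f_seq p i) \<and>
      extension_degree (tower_field (f_seq p) (i - 1)) (tower_field (f_seq p) i)
        (tower_emb (f_seq p :: nat \<Rightarrow> 'a mpoly) i) p" if i: "i \<in> {1..l}" for i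
  proof -
    obtain n where "i = Suc n" using i by (cases i) auto
    thus ?thesis
      by (simp add: carrier_mpoly_ring f_seq_in_mpoly_carrier monic_in_f_seq[OF p1]
          f_seq_irreducible_mod_J extension_degree_tower)
  qed
  thus ?thesis by (simp add: defines_tower_def)
qed

end
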